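(* Let $d\ge 1$ be an integer, let $c$ be an indeterminate and let $f_c(z)=z^{d+1}+cz$. For every positive integer $m$, the polynomial $d^{\deg_z\Phi_m^*/(d+1)}\,\delta_m(x)$ is an element of $\mathbb{Z}[dc,x]$ and is monic in $dc$ up to multiplication by $\pm1$ (that is, viewed as a polynomial in $t=dc$ with coefficients in $\mathbb{Z}[x]$ its leading coefficient is $\pm 1$).
   Context: Regard $f=f_c$ as a polynomial in $z$ over $\mathbb{Z}[c]$; $f^{\circ k}$ denotes the $k$-th iterate and $\mu$ the Möbius function. The $m$-th dynatomic polynomial is $\Phi_m^*(z)=\prod_{k\mid m}(f^{\circ k}(z)-z)^{\mu(m/k)}$, of degree $\sum_{k\mid m}(d+1)^k\mu(m/k)$ in $z$. For a root $\alpha\in\overline{\mathbb{Q}(c)}$ of $\Phi_m^*$ its multiplier is $\omega_m(\alpha)=(f^{\circ m})'(\alpha)$. The $m$-th multiplier polynomial $\delta_m(x)\in\mathbb{Z}[c][x]$ is the monic polynomial in $x$ satisfying $\delta_m(x)^m=\prod_{\Phi_m^*(\alpha)=0}(x-\omega_m(\alpha))$ (roots counted with multiplicity). *)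

theory Defs
  imports "HOL-Algebra.Algebraic_Closure_Type"
begin

text \<open>
  The type \<^typ>\<open>int poly\<close> is read as the ring of integer polynomials in the indeterminate c,
  so an \<^typ>\<open>int poly poly\<close> is a polynomial over it, whose outer variable is z for
  the iterates and the dynatomic polynomials and x for the multiplier polynomials.
  The fraction field \<^typ>\<open>int poly fract\<close> is the field of rational functions in c over
  the rationals; \<^typ>\<open>int poly fract alg_closure\<close> is its algebraic closure.
\<close>

definition moebius :: "nat \<Rightarrow> int" where
  "moebius n = (if squarefree n then (-1) ^ card (prime_factors n) else 0)"

definition f_poly :: "nat \<Rightarrow> int poly poly" where
  "f_poly d = Polynomial.monom 1 (d + 1) + Polynomial.monom [:0, 1:] 1"

definition f_iter :: "nat \<Rightarrow> nat \<Rightarrow> int poly poly" where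
  "f_iter d k = (pcompose (f_poly d) ^^ k) [:0, 1:]"

text \<open>
  Some of the exponents are negative, so the defining product is formed in the fraction field;
  it is (the image of) a polynomial. Its degree, the sum of (d+1)^k moebius (m div k) over the
  divisors k of m, is divisible by d+1, so dividing that degree by d+1 in the naturals is exact.
\<close>

definition dynatomic :: "nat \<Rightarrow> nat \<Rightarrow> int poly poly" where
  "dynatomic d m = (THE p. to_fract p =
     (\<Prod>k | k dvd m. to_fract (f_iter d k - [:0, 1:]) powi moebius (m div k)))"

definition to_closure :: "int poly \<Rightarrow> int poly fract alg_closure" where
  "to_closure a = to_ac (to_fract a)"

definition multiplier :: "nat \<Rightarrow> nat \<Rightarrow> int poly fract alg_closure \<Rightarrow> int poly fract alg_closure" where
  "multiplier d m \<alpha> = poly (map_poly to_closure (pderiv (f_iter d m))) \<alpha>"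

definition multiplier_poly :: "nat \<Rightarrow> nat \<Rightarrow> int poly poly" where
  "multiplier_poly d m = (THE q. Polynomial.lead_coeff q = 1 \<and>
     map_poly to_closure q ^ m =
       (\<Prod>\<alpha>\<in>#proots (map_poly to_closure (dynatomic d m)). [:- multiplier d m \<alpha>, 1:]))"

text \<open>
  Here P is a polynomial in an outer variable t over the integer polynomials in x. The result is
  the polynomial over \<^typ>\<open>int poly\<close> (outer variable x, coefficients in c) obtained by
  substituting a for t: the coefficients of P, which lie in \<^typ>\<open>int poly\<close>, are first
  embedded by regarding each integer coefficient as a constant polynomial in c.
\<close>

definition subst_t :: "int poly poly \<Rightarrow> int poly \<Rightarrow> int poly poly" where
  "subst_t P a = poly (map_poly (map_poly (\<lambda>n. [:n:])) P) [:a:]"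

end

theory Submission
  imports Defs "Jordan_Normal_Form.Char_Poly"
begin

text \<open>
Write \<open>\<lambda>(z) = (d+1) z^d + c\<close> for the derivative of \<open>f\<close> and put \<open>t = d c\<close>; the multiplier of a point of
period \<open>m\<close> is the product of \<open>\<lambda>\<close> along its orbit. The proof has four ideas.

Denominators. The ratio \<open>u = f(z)/z = z^d + c\<close> satisfies \<open>\<lambda>(z) = (d+1) u - t\<close>, and \<open>f\<close> moves it by
\<open>U(u) = u^(d+1) + c (1 - u^d)\<close>. Here \<open>d U\<close> has coefficients in \<open>\<int>[t]\<close>, so a power of \<open>d\<close>
clears the denominators of each iterate of \<open>U\<close>, and the same power then is its leading coefficient in \<open>u\<close>.
The product of \<open>x - \<lambda>(z)\<close> over the solutions of \<open>f^m(z) = z\<close> is an explicit expression in these iterates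
(\<open>prod_fixed_points_minus_power\<close>). Multiplied by \<open>d^((d+1)^(m-1))\<close> it becomes a polynomial in \<open>\<int>[x][t]\<close>
of degree \<open>(d+1)^m\<close> in \<open>t\<close> whose leading coefficient in \<open>t\<close> is 1 or -1.

Exact periods. A unit leading coefficient is inherited by factors, and a polynomial with unit leading
coefficient that divides a nonzero integer multiple of an element of \<open>\<int>[x][t]\<close> divides the element itself. So the
points of exact period \<open>m\<close> contribute a factor with the same properties, scaled by exactly \<open>d^(N/(d+1))\<close>, where \<open>N\<close> is their number
(\<open>exact_derivative_poly_exists\<close>).

From derivatives to multipliers. If \<open>a\<close> times a product of \<open>X - r\<^sub>i\<close> has integral coefficients, then
\<open>a\<close> times the product of any selection of the \<open>r\<^sub>i\<close> is integral (Kronecker, \<open>integral_subset_product\<close>).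
The coefficients of the multiplier polynomial, a product over the cycles, are sums of products of \<open>\<lambda>\<close> over
unions of cycles; multiplied by \<open>d^(N/(d+1))\<close> they are therefore integral over \<open>\<int>[t]\<close>. They are also
rational functions of \<open>c\<close>, so they lie in the integrally closed ring \<open>\<int>[t]\<close>.
For the leading coefficient, \<open>\<lambda>(z)/c\<close> is integral over \<open>\<int>[1/c]\<close>, which bounds the degree in \<open>c\<close> of the
coefficient of \<open>x^j\<close> by \<open>N - m j\<close>. So \<open>t^N\<close> can occur only in the constant term, and there its
coefficient is, up to sign, the leading coefficient found before.

Existence. That the dynatomic and multiplier polynomials have coefficients in \<open>\<int>[c]\<close> rests on the simplicity of
the periodic points: modulo \<open>c\<close> one has \<open>z \<lambda>(z) = (d+1) f(z)\<close>, which excludes the multiplier 1.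
Moebius inversion then gives the points of exact period \<open>m\<close> as the roots of the dynatomic polynomial, and
Newton's identities show that the product over the cycles is defined over the rational functions in \<open>c\<close>.
\<close>

hide_const (open) Module.smult UnivPoly.coeff UnivPoly.monom Coset.order
  Polynomials.degree Polynomials.lead_coeff

section \<open>Integral elements over a subring of a field\<close>

text \<open>
The subring is given as the image of an injective homomorphism, because three different embeddings of
\<open>\<int>[T]\<close> into one field are used below: \<open>T\<close> is sent to \<open>c\<close>, to \<open>d c\<close> and to \<open>1/c\<close>.
\<close>

locale integral_closure = inj_comm_ring_hom hom
  for hom :: "'r::comm_ring_1 \<Rightarrow> 'l::field"
begin

definition integral :: "'l \<Rightarrow> bool" where
  "integral x \<longleftrightarrow> (\<exists>p. monic p \<and> poly (map_poly hom p) x = 0)"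

sublocale M: Modules.module "\<lambda>r x. hom r * x"
  by unfold_locales (simp_all add: algebra_simps hom_distribs)

text \<open>
An element is integral if and only if multiplication by it maps some finitely generated module that contains
1 into itself. Since the stabilizer of a module is visibly a ring, sums and products of integral
elements are integral.
\<close>

definition stabilizer :: "'l set \<Rightarrow> 'l set" where
  "stabilizer B = {x. \<forall>b\<in>B. x * b \<in> M.span B}"

definition power_extension :: "'l set \<Rightarrow> 'l \<Rightarrow> nat \<Rightarrow> 'l set" where
  "power_extension B a n = (\<lambda>(b, i). b * a ^ i) ` (B \<times> {..<n})"

lemma power_extensionI: "b \<in> B \<Longrightarrow> i < n \<Longrightarrow> b * a ^ i \<in> power_extension B a n"
  unfolding power_extension_def by (rule rev_image_eqI[of "(b, i)"]) auto

lemma span_times: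
  assumes "v \<in> M.span B" and "\<And>b. b \<in> B \<Longrightarrow> b * c \<in> M.span D"
  shows "v * c \<in> M.span D"
  using assms(1)
proof (induction rule: M.span_induct_alt)
  case base
  show ?case by (simp add: M.span_zero)
next
  case (step r b y)
  have "(hom r * b + y) * c = hom r * (b * c) + y * c"
    by (simp add: algebra_simps)
  then show ?case
    using step assms(2) by (simp add: M.span_add M.span_scale)
qed

lemma stabilizer_span: "x \<in> stabilizer B \<Longrightarrow> v \<in> M.span B \<Longrightarrow> x * v \<in> M.span B"
  using span_times[of v B x B] by (simp add: stabilizer_def mult.commute)

lemma stabilizer_hom: "hom r \<in> stabilizer B"
  by (simp add: stabilizer_def M.span_base M.span_scale)

lemma stabilizer_add: "x \<in> stabilizer B \<Longrightarrow> y \<in> stabilizer B \<Longrightarrow> x + y \<in> stabilizer B"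
  by (simp add: stabilizer_def M.span_add distrib_right)

lemma stabilizer_uminus: "x \<in> stabilizer B \<Longrightarrow> - x \<in> stabilizer B"
  by (simp add: stabilizer_def M.span_neg)

lemma stabilizer_mult: "x \<in> stabilizer B \<Longrightarrow> y \<in> stabilizer B \<Longrightarrow> x * y \<in> stabilizer B"
  using stabilizer_span[of x B] by (simp add: stabilizer_def mult.assoc)

lemma stabilizer_products:
  assumes "x \<in> stabilizer B"
  shows "x \<in> stabilizer ((\<lambda>(b, c). b * c) ` (B \<times> C))"
  unfolding stabilizer_def
proof safe
  fix b c assume "b \<in> B" "c \<in> C"
  then have "b' * c \<in> M.span ((\<lambda>(b, c). b * c) ` (B \<times> C))" if "b' \<in> B" for b'
    using that by (intro M.span_base rev_image_eqI[of "(b', c)"]) auto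
  then have "x * b * c \<in> M.span ((\<lambda>(b, c). b * c) ` (B \<times> C))"
    using assms \<open>b \<in> B\<close> by - (rule span_times[where B = B], auto simp: stabilizer_def)
  then show "x * (b * c) \<in> M.span ((\<lambda>(b, c). b * c) ` (B \<times> C))"
    by (simp add: mult.assoc)
qed

lemma poly_in_span_power_extension:
  assumes "\<And>i. coeff q i \<in> stabilizer B" and "\<And>i. n \<le> i \<Longrightarrow> coeff q i = 0" and "b \<in> B"
  shows "poly q a * b \<in> M.span (power_extension B a n)"
proof -
  have "coeff q i * a ^ i * b \<in> M.span (power_extension B a n)" if "i \<le> degree q" for i
  proof (cases "i < n")
    case True
    have "b' * a ^ i \<in> M.span (power_extension B a n)" if "b' \<in> B" for b'
      using that True by (intro M.span_base power_extensionI)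
    then have "(coeff q i * b) * a ^ i \<in> M.span (power_extension B a n)"
      using assms(1,3) by - (rule span_times[where B = B], auto simp: stabilizer_def)
    then show ?thesis by (simp add: mult_ac)
  next
    case False
    then show ?thesis using assms(2) by (simp add: M.span_zero)
  qed
  then show ?thesis
    unfolding poly_altdef sum_distrib_right by (intro M.span_sum) auto
qed

text \<open>
Multiplication by \<open>x\<close> on the generators is given by a matrix over the subring, and the vector of
generators is an eigenvector. So \<open>x\<close> is a root of the characteristic polynomial, which is monic.
\<close>

lemma integral_of_stabilizer:
  assumes "finite B" "1 \<in> B" "x \<in> stabilizer B"
  shows "integral x"
proof -
  define n where "n = card B"
  obtain b where b: "bij_betw b {0..<n} B"
    using ex_bij_betw_nat_finite[OF assms(1)] by (auto simp: n_def)
  have "\<exists>c. x * b i = (\<Sum>j<n. hom (c j) * b j)" if "i < n" for i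
  proof -
    have "x * b i \<in> M.span B"
      using assms(3) b that by (auto simp: stabilizer_def bij_betw_def)
    then obtain u where "x * b i = (\<Sum>v\<in>B. hom (u v) * v)"
      using assms(1) by (auto simp: M.span_finite)
    also have "\<dots> = (\<Sum>j<n. hom (u (b j)) * b j)"
      using sum.reindex_bij_betw[OF b, of "\<lambda>v. hom (u v) * v"] by (simp add: atLeast0LessThan)
    finally show ?thesis by (intro exI[of _ "\<lambda>j. u (b j)"])
  qed
  then obtain c where c: "\<And>i. i < n \<Longrightarrow> x * b i = (\<Sum>j<n. hom (c i j) * b j)"
    by metis
  define A where "A = mat n n (\<lambda>(i, j). c i j)"
  have A: "A \<in> carrier_mat n n" by (simp add: A_def)
  obtain k where k: "k < n" "b k = 1"
    using b assms(2) by (metis atLeastLessThan_iff bij_betw_iff_bijections)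
  have "map_mat hom A *\<^sub>v vec n b = x \<cdot>\<^sub>v vec n b"
    by (rule eq_vecI) (auto simp: A_def c scalar_prod_def atLeast0LessThan)
  moreover have "vec n b \<noteq> 0\<^sub>v n"
    using k by (metis index_vec index_zero_vec(1) zero_neq_one)
  ultimately have "eigenvector (map_mat hom A) (vec n b) x"
    using A by (auto simp: eigenvector_def)
  then have "poly (char_poly (map_mat hom A)) x = 0"
    using A eigenvalue_root_char_poly[of "map_mat hom A" n x] by (auto simp: eigenvalue_def)
  then show ?thesis
    unfolding integral_def char_poly_hom[OF A] using degree_monic_char_poly[OF A] by auto
qed

text \<open>
The module is spanned by the powers of \<open>x\<close> below the degree of its monic equation.
\<close>

lemma stabilizer_of_integral:
  assumes "integral x"
  shows "\<exists>B. finite B \<and> 1 \<in> B \<and> x \<in> stabilizer B"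
proof -
  obtain p where p: "monic p" "poly (map_poly hom p) x = 0"
    using assms by (auto simp: integral_def)
  define n where "n = degree p"
  have n: "n > 0"
  proof (rule ccontr)
    assume "\<not> n > 0"
    then have "p = 1" using p(1) by (simp add: n_def monic_degree_0)
    then show False using p(2) by simp
  qed
  let ?B = "power_extension {1} x n"
  define q where "q = monom 1 n - map_poly hom p"
  have q: "x ^ n = poly q x"
    using p(2) by (simp add: q_def poly_monom)
  have q_coeff: "coeff q i = 0" if "n \<le> i" for i
    using that p(1) by (cases "i = n") (auto simp: q_def n_def coeff_eq_0)
  have "coeff q i = hom ((if i = n then 1 else 0) - coeff p i)" for i
    by (simp add: q_def hom_distribs)
  then have q_stab: "coeff q i \<in> stabilizer {1}" for i
    using stabilizer_hom by metis
  have "x ^ Suc i \<in> M.span ?B" if "i < n" for i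
  proof (cases "Suc i < n")
    case True
    then have "1 * x ^ Suc i \<in> M.span ?B" by (intro M.span_base power_extensionI) auto
    then show ?thesis by simp
  next
    case False
    then have "Suc i = n" using that by simp
    then show ?thesis
      using poly_in_span_power_extension[of q "{1}" n 1 x, OF q_stab q_coeff] q by simp
  qed
  then have "x \<in> stabilizer ?B"
    by (auto simp: stabilizer_def power_extension_def)
  moreover have "1 \<in> ?B"
    using n power_extensionI[of 1 "{1}" 0 n x] by simp
  moreover have "finite ?B" by (simp add: power_extension_def)
  ultimately show ?thesis by blast
qed

text \<open>
A product of two modules is stable under everything that stabilizes one of the factors.
\<close>

lemma common_stabilizer:
  assumes "finite T" "\<And>x. x \<in> T \<Longrightarrow> integral x"
  shows "\<exists>B. finite B \<and> 1 \<in> B \<and> T \<subseteq> stabilizer B"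
  using assms
proof (induction T rule: finite_induct)
  case empty
  show ?case by (intro exI[of _ "{1}"]) simp
next
  case (insert x T)
  obtain B where B: "finite B" "1 \<in> B" "T \<subseteq> stabilizer B"
    using insert.IH insert.prems by blast
  obtain C where C: "finite C" "1 \<in> C" "x \<in> stabilizer C"
    using stabilizer_of_integral[of x] insert.prems by blast
  have swap: "(\<lambda>(b, c). b * c) ` (B \<times> C) = (\<lambda>(c, b). c * b) ` (C \<times> B)"
    unfolding product_swap[of C B, symmetric] image_image
    by (simp add: case_prod_unfold mult.commute)
  have "x \<in> stabilizer ((\<lambda>(b, c). b * c) ` (B \<times> C))"
    using stabilizer_products[OF C(3), of B] by (simp only: swap)
  moreover have "T \<subseteq> stabilizer ((\<lambda>(b, c). b * c) ` (B \<times> C))"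
    using stabilizer_products B(3) by blast
  moreover have "1 \<in> (\<lambda>(b, c). b * c) ` (B \<times> C)"
    using B(2) C(2) by (intro rev_image_eqI[of "(1, 1)"]) auto
  moreover have "finite ((\<lambda>(b, c). b * c) ` (B \<times> C))" using B(1) C(1) by simp
  ultimately show ?case by (metis insert_subset)
qed

lemma integral_hom: "integral (hom r)"
  using integral_of_stabilizer[of "{1}"] stabilizer_hom by auto

lemma common_stabilizer_pair:
  assumes "integral x" "integral y"
  obtains B where "finite B" "1 \<in> B" "x \<in> stabilizer B" "y \<in> stabilizer B"
proof -
  have "\<And>z. z \<in> {x, y} \<Longrightarrow> integral z" using assms by auto
  then obtain B where "finite B" "1 \<in> B" "{x, y} \<subseteq> stabilizer B"
    using common_stabilizer[of "{x, y}"] by blast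
  then show ?thesis using that by simp
qed

lemma integral_add: "integral x \<Longrightarrow> integral y \<Longrightarrow> integral (x + y)"
  by (metis common_stabilizer_pair integral_of_stabilizer stabilizer_add)

lemma integral_mult: "integral x \<Longrightarrow> integral y \<Longrightarrow> integral (x * y)"
  by (metis common_stabilizer_pair integral_of_stabilizer stabilizer_mult)

lemma integral_uminus: "integral x \<Longrightarrow> integral (- x)"
  using stabilizer_of_integral integral_of_stabilizer stabilizer_uminus by blast

lemma integral_diff: "integral x \<Longrightarrow> integral y \<Longrightarrow> integral (x - y)"
  using integral_add[of x "- y"] integral_uminus by simp

lemma integral_0 [simp]: "integral 0"
  using integral_hom[of 0] by simp

lemma integral_1 [simp]: "integral 1"
  using integral_hom[of 1] by simp

lemma integral_of_nat: "integral (of_nat k)"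
  using integral_hom[of "of_nat k"] by (simp add: hom_distribs)

lemma integral_power: "integral x \<Longrightarrow> integral (x ^ k)"
  by (induction k) (auto intro: integral_mult)

lemma integral_sum: "(\<And>i. i \<in> A \<Longrightarrow> integral (f i)) \<Longrightarrow> integral (sum f A)"
  by (induction A rule: infinite_finite_induct) (auto intro: integral_add)

lemma integral_prod: "(\<And>i. i \<in> A \<Longrightarrow> integral (f i)) \<Longrightarrow> integral (prod f A)"
  by (induction A rule: infinite_finite_induct) (auto intro: integral_mult)

lemmas integral_intros = integral_hom integral_add integral_mult integral_uminus integral_diff
  integral_0 integral_1 integral_of_nat integral_power integral_sum integral_prod

lemma integral_coeff_linear_product:
  assumes "\<And>i. i \<in> A \<Longrightarrow> integral (r i)"
  shows "integral (coeff (\<Prod>i\<in>A. [:- r i, 1:]) j)"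
  using assms
proof (induction A arbitrary: j rule: infinite_finite_induct)
  case (insert i A)
  have "coeff ([:- r i, 1:] * Q) j = - r i * coeff Q j + (case j of 0 \<Rightarrow> 0 | Suc l \<Rightarrow> coeff Q l)" for Q
    by (simp add: coeff_pCons)
  then show ?case
    using insert by (auto intro!: integral_add integral_mult integral_uminus integral_diff split: nat.split)
qed (auto simp: of_bool_def)

text \<open>
This is the step of Kronecker's lemma. The coefficient \<open>Q\<^sub>j\<close> is the value at \<open>a\<close> of the upper part of \<open>P\<close>,
and \<open>a^(j+1) Q\<^sub>j\<close> is minus the value of the lower part. Whichever of the two is used, \<open>Q\<^sub>j a^i\<close> with
\<open>i < degree P\<close> is a combination of powers of \<open>a\<close> below \<open>degree P\<close>, with the coefficients of \<open>P\<close>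
as coefficients. So \<open>Q\<^sub>j\<close> stabilizes a finitely generated module.
\<close>

lemma integral_coeff_quotient:
  assumes P: "\<And>i. integral (coeff P i)" and PQ: "P = [:- a, 1:] * Q"
  shows "integral (coeff Q j)"
proof (cases "P = 0")
  case True
  then have "Q = 0" using PQ by (metis mult_eq_0_iff one_neq_zero pCons_eq_0_iff)
  then show ?thesis by simp
next
  case False
  define n where "n = degree P"
  have Q0: "Q \<noteq> 0" using PQ False by auto
  have n: "n = Suc (degree Q)"
    unfolding n_def PQ using Q0 by (subst degree_mult_eq) auto
  have rec: "coeff Q i = coeff P (Suc i) + a * coeff Q (Suc i)" for i
    unfolding PQ by simp
  have Q_shift: "coeff Q j = poly (poly_shift (Suc j) P) a" for j
  proof (induction "n - j" arbitrary: j)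
    case 0
    then have "poly_shift (Suc j) P = 0"
      by (intro poly_eqI) (simp add: coeff_poly_shift coeff_eq_0 n_def)
    then show ?case using 0 n by (simp add: coeff_eq_0)
  next
    case (Suc k)
    have "poly_shift (Suc j) P = pCons (coeff P (Suc j)) (poly_shift (Suc (Suc j)) P)"
      by (intro poly_eqI) (auto simp: coeff_poly_shift coeff_pCons split: nat.split)
    then show ?case using Suc by (simp add: rec[of j])
  qed
  have split: "P = poly_cutoff (Suc j) P + monom 1 (Suc j) * poly_shift (Suc j) P"
    by (intro poly_eqI) (auto simp: coeff_poly_cutoff coeff_poly_shift coeff_monom_mult)
  have "poly P a = 0" by (simp add: PQ)
  then have cutoff: "a ^ Suc j * coeff Q j = - poly (poly_cutoff (Suc j) P) a"
    by (subst (asm) split) (simp add: poly_monom Q_shift[symmetric] eq_neg_iff_add_eq_0 add.commute)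
  obtain B where B: "finite B" "1 \<in> B" "range (coeff P) \<subseteq> stabilizer B"
  proof -
    have "range (coeff P) \<subseteq> coeff P ` {..n} \<union> {0}"
      by (auto simp: n_def image_iff) (metis atMost_iff le_degree)
    then have "finite (range (coeff P))" by (rule finite_subset) simp
    then show ?thesis using common_stabilizer[of "range (coeff P)"] P that by blast
  qed
  have stab0: "0 \<in> stabilizer B" using stabilizer_hom[of 0 B] by simp
  let ?B = "power_extension B a n"
  have "coeff Q j * (b * a ^ i) \<in> M.span ?B" if "b \<in> B" "i < n" for b i
  proof (cases "i \<le> j")
    case True
    let ?q = "monom 1 i * poly_shift (Suc j) P"
    have "poly ?q a * b \<in> M.span ?B"
      using that True B(3) stab0
      by (intro poly_in_span_power_extension)
        (auto simp: coeff_monom_mult coeff_poly_shift n_def coeff_eq_0)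
    then show ?thesis by (simp add: poly_monom Q_shift[symmetric] mult_ac)
  next
    case False
    let ?q = "- (monom 1 (i - Suc j) * poly_cutoff (Suc j) P)"
    have "poly ?q a * b \<in> M.span ?B"
      using that False B(3) stab0
      by (intro poly_in_span_power_extension)
        (auto simp: coeff_monom_mult coeff_poly_cutoff intro!: stabilizer_uminus)
    moreover have "poly ?q a = coeff Q j * a ^ i"
    proof -
      have "a ^ i = a ^ (i - Suc j) * a ^ Suc j"
        using False by (metis Suc_leI le_add_diff_inverse2 not_le power_add)
      have "poly ?q a = a ^ (i - Suc j) * (a ^ Suc j * coeff Q j)"
        unfolding cutoff by (simp add: poly_monom)
      also have "\<dots> = coeff Q j * a ^ i"
        unfolding \<open>a ^ i = _\<close> by (simp only: mult_ac)
      finally show ?thesis .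
    qed
    ultimately have "coeff Q j * a ^ i * b \<in> M.span ?B" by (simp only:)
    moreover have "coeff Q j * a ^ i * b = coeff Q j * (b * a ^ i)" by (simp only: mult_ac)
    ultimately show ?thesis by (simp only:)
  qed
  then have "coeff Q j \<in> stabilizer ?B"
    by (auto simp: stabilizer_def power_extension_def)
  moreover have "1 \<in> ?B" using B(2) n power_extensionI[of 1 B 0 n a] by simp
  moreover have "finite ?B" using B(1) by (simp add: power_extension_def)
  ultimately show ?thesis using integral_of_stabilizer by blast
qed

lemma integral_coeff_subproduct:
  assumes "finite A" "S \<subseteq> A"
    and "\<And>j. integral (coeff (smult a (\<Prod>i\<in>A. [:- r i, 1:])) j)"
  shows "integral (coeff (smult a (\<Prod>i\<in>S. [:- r i, 1:])) j)"
proof -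
  have "integral (coeff (smult a (\<Prod>i\<in>A - D. [:- r i, 1:])) j)"
    if "finite D" "D \<subseteq> A" for D j
    using that
  proof (induction D arbitrary: j rule: finite_induct)
    case empty
    then show ?case using assms(3) by simp
  next
    case (insert x D)
    have "(\<Prod>i\<in>A - D. [:- r i, 1:]) = [:- r x, 1:] * (\<Prod>i\<in>A - D - {x}. [:- r i, 1:])"
      using assms(1) insert.hyps(2) insert.prems by (intro prod.remove) auto
    then have "smult a (\<Prod>i\<in>A - D. [:- r i, 1:])
        = [:- r x, 1:] * smult a (\<Prod>i\<in>A - insert x D. [:- r i, 1:])"
      by (metis mult_smult_right Diff_insert)
    then show ?case
      using integral_coeff_quotient insert by (metis insert_subset)
  qed
  from this[of "A - S" j] show ?thesis
    using assms(1,2) by (simp add: double_diff)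
qed

text \<open>
Kronecker's lemma: the unwanted roots are divided out one after the other, and the constant coefficient of
what remains is the product in question.
\<close>

lemma integral_subset_product:
  assumes "finite A" "S \<subseteq> A"
    and "\<And>j. integral (coeff (smult a (\<Prod>i\<in>A. [:- r i, 1:])) j)"
  shows "integral (a * (\<Prod>i\<in>S. r i))"
proof -
  have "integral (coeff (smult a (\<Prod>i\<in>S. [:- r i, 1:])) 0)"
    by (rule integral_coeff_subproduct[OF assms])
  moreover have "coeff (smult a (\<Prod>i\<in>S. [:- r i, 1:])) 0 = (- 1) ^ card S * (a * (\<Prod>i\<in>S. r i))"
    by (simp add: poly_0_coeff_0[symmetric] poly_prod prod_uminus)
  ultimately have "integral ((- 1) ^ card S * ((- 1) ^ card S * (a * (\<Prod>i\<in>S. r i))))"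
    by (metis integral_mult integral_power integral_uminus integral_1)
  then show ?thesis
    by (simp flip: mult.assoc power_add)
qed

end

text \<open>
The rational root argument: for a quotient \<open>p/q\<close> in lowest terms the monic equation makes \<open>q\<close> divide a power
of \<open>p\<close>.
\<close>

lemma integrally_closed:
  fixes hom :: "'r :: {factorial_ring_gcd} \<Rightarrow> 'l :: field"
  assumes "integral_closure hom" and "integral_closure.integral hom x"
    and "x * hom q = hom p" and "q \<noteq> 0"
  shows "x \<in> range hom"
proof -
  interpret integral_closure hom by fact
  define g where "g = gcd p q"
  obtain p' q' where pq: "p = p' * g" "q = q' * g" "coprime p' q'"
    using gcd_coprime_exists[of p q] assms(4) unfolding g_def by (metis gcd_eq_0_iff)
  have "g \<noteq> 0" using assms(4) by (simp add: g_def)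
  moreover have "(x * hom q') * hom g = hom p' * hom g"
    using assms(3) by (metis pq(1,2) hom_mult mult.assoc)
  ultimately have x: "x * hom q' = hom p'" by simp
  obtain f where f: "monic f" "poly (map_poly hom f) x = 0"
    using assms(2) by (auto simp: integral_def)
  define n where "n = degree f"
  have "hom (\<Sum>i\<le>n. coeff f i * p' ^ i * q' ^ (n - i))
      = (\<Sum>i\<le>n. hom (coeff f i) * x ^ i) * hom q' ^ n"
    unfolding hom_sum sum_distrib_right
  proof (intro sum.cong refl)
    fix i assume "i \<in> {..n}"
    then have "hom q' ^ n = hom q' ^ i * hom q' ^ (n - i)"
      by (simp flip: power_add)
    then show "hom (coeff f i * p' ^ i * q' ^ (n - i)) = hom (coeff f i) * x ^ i * hom q' ^ n"
      by (simp add: hom_mult hom_power x[symmetric] power_mult_distrib mult_ac)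
  qed
  also have "(\<Sum>i\<le>n. hom (coeff f i) * x ^ i) = 0"
    using f(2) by (simp add: poly_altdef n_def)
  finally have "(\<Sum>i\<le>n. coeff f i * p' ^ i * q' ^ (n - i)) = 0" by simp
  also have "(\<Sum>i\<le>n. coeff f i * p' ^ i * q' ^ (n - i))
      = p' ^ n + (\<Sum>i<n. coeff f i * p' ^ i * q' ^ (n - i))"
    using f(1) by (simp add: lessThan_Suc_atMost[symmetric] n_def add.commute)
  finally have "p' ^ n = - (\<Sum>i<n. coeff f i * p' ^ i * q' ^ (n - i))"
    by (simp add: eq_neg_iff_add_eq_0)
  moreover have "q' dvd (\<Sum>i<n. coeff f i * p' ^ i * q' ^ (n - i))"
    by (intro dvd_sum) auto
  ultimately have "q' dvd p' ^ n" by simp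
  moreover have "coprime q' (p' ^ n)" using pq(3) by (simp add: coprime_commute)
  ultimately have "q' dvd 1"
    using coprime_absorb_left[of q' "p' ^ n"] by blast
  then obtain r where "1 = q' * r" by (elim dvdE)
  then have "hom q' * hom r = 1" by (metis hom_mult hom_one)
  then have "x = hom (p' * r)" by (metis x hom_mult mult.assoc mult.right_neutral)
  then show ?thesis by blast
qed

section \<open>Moebius inversion\<close>

lemma moebius_mult_prime:
  assumes "prime p" "\<not> p dvd k" "k > 0"
  shows "moebius (p * k) = - moebius k"
proof -
  have cop: "coprime p k" using assms by (simp add: prime_imp_coprime)
  have "squarefree (p * k) \<longleftrightarrow> squarefree k"
    using cop assms(1) by (auto simp: squarefree_mult_coprime squarefree_prime dest: squarefree_multD)
  moreover have "prime_factors (p * k) = insert p (prime_factors k)"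
    using assms by (subst prime_factors_product) (auto simp: prime_prime_factors)
  moreover have "p \<notin> prime_factors k" using assms by auto
  ultimately show ?thesis by (simp add: moebius_def)
qed

text \<open>
For a prime \<open>p\<close> dividing \<open>n\<close>, multiplication by \<open>p\<close> pairs the divisors prime to \<open>p\<close> with those divisible by \<open>p\<close>
exactly once, and changes the sign; the Moebius function vanishes on all other divisors.
\<close>

lemma sum_moebius_divisors:
  assumes "n > 0"
  shows "(\<Sum>k | k dvd n. moebius k) = (if n = 1 then 1 else 0)"
proof (cases "n = 1")
  case True
  then show ?thesis by (simp add: moebius_def)
next
  case False
  then obtain p where p: "prime p" "p dvd n" using prime_factor_nat by blast
  have fin: "finite {k. k dvd n}" using assms by simp
  let ?A = "{k. k dvd n \<and> \<not> p dvd k}" and ?B = "{k. k dvd n \<and> p dvd k}"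
  have "(\<Sum>k\<in>?B. moebius k) = (\<Sum>k\<in>(*) p ` ?A. moebius k)"
  proof (rule sum.mono_neutral_right)
    show "finite ?B" using fin by simp
    show "(*) p ` ?A \<subseteq> ?B"
      using p by (auto intro!: divides_mult simp: prime_imp_coprime)
    show "\<forall>k\<in>?B - (*) p ` ?A. moebius k = 0"
    proof
      fix k assume k: "k \<in> ?B - (*) p ` ?A"
      then obtain j where j: "k = p * j" by (auto elim: dvdE)
      then have "p dvd j" using k by (auto intro: dvd_mult_right)
      then have "p\<^sup>2 dvd k" by (simp add: j power2_eq_square mult_dvd_mono)
      then show "moebius k = 0"
        using p(1) by (auto simp: moebius_def squarefree_def)
    qed
  qed
  also have "\<dots> = (\<Sum>k\<in>?A. moebius (p * k))"
    using p(1) by (subst sum.reindex) (auto simp: inj_on_def prime_gt_0_nat)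
  also have "\<dots> = (\<Sum>k\<in>?A. - moebius k)"
    using p(1) assms by (intro sum.cong refl moebius_mult_prime) (auto intro: dvd_pos_nat)
  finally have "(\<Sum>k\<in>?A. moebius k) + (\<Sum>k\<in>?B. moebius k) = 0"
    by (simp add: sum_negf)
  moreover have "sum moebius {k. k dvd n} = sum moebius (?A \<union> ?B)"
    by (rule sum.cong) auto
  moreover have "sum moebius (?A \<union> ?B) = sum moebius ?A + sum moebius ?B"
    by (rule sum.union_disjoint) (use fin in auto)
  ultimately have "sum moebius {k. k dvd n} = 0" by linarith
  then show ?thesis using False by simp
qed

lemma power_int_sum:
  fixes x :: "'a::field"
  assumes "x \<noteq> 0"
  shows "x powi (\<Sum>i\<in>A. f i) = (\<Prod>i\<in>A. x powi f i)"
  by (induction A rule: infinite_finite_induct) (simp_all add: assms power_int_add)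

lemma prod_power_int:
  fixes f :: "'b \<Rightarrow> 'a::field"
  shows "(\<Prod>i\<in>A. f i) powi k = (\<Prod>i\<in>A. f i powi k)"
  by (induction A rule: infinite_finite_induct) (simp_all add: power_int_mult_distrib)

lemma multiplicative_moebius_inversion:
  fixes D :: "nat \<Rightarrow> 'a::field"
  assumes "m > 0" and "\<And>k. k dvd m \<Longrightarrow> D k \<noteq> 0"
    and "\<And>k. k dvd m \<Longrightarrow> F k = (\<Prod>j | j dvd k. D j)"
  shows "(\<Prod>k | k dvd m. F k powi moebius (m div k)) = D m"
proof -
  have fin: "finite {k. k dvd m}" using assms(1) by simp
  have "(\<Prod>k | k dvd m. F k powi moebius (m div k))
      = (\<Prod>k\<in>{k. k dvd m}. \<Prod>j\<in>{j. j \<in> {j. j dvd m} \<and> j dvd k}. D j powi moebius (m div k))"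
    using assms(3) by (auto simp: prod_power_int intro!: prod.cong dest: dvd_trans)
  also have "\<dots> = (\<Prod>j\<in>{j. j dvd m}. \<Prod>k\<in>{k. k \<in> {k. k dvd m} \<and> j dvd k}. D j powi moebius (m div k))"
    by (rule prod.swap_restrict[OF fin fin])
  also have "\<dots> = (\<Prod>j\<in>{j. j dvd m}. if j = m then D j else 1)"
  proof (intro prod.cong refl)
    fix j assume "j \<in> {j. j dvd m}"
    then have j: "j dvd m" "j > 0" using assms(1) by (auto intro: dvd_pos_nat)
    have "(\<Sum>k\<in>{k. k \<in> {k. k dvd m} \<and> j dvd k}. moebius (m div k)) = (\<Sum>e | e dvd m div j. moebius e)"
    proof (rule sum.reindex_bij_witness[of _ "\<lambda>e. m div e" "\<lambda>k. m div k"])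
      fix k assume k: "k \<in> {k. k \<in> {k. k dvd m} \<and> j dvd k}"
      then obtain a b where ab: "m = k * a" "k = j * b" by (auto elim!: dvdE)
      then show "m div k \<in> {e. e dvd m div j}" "m div (m div k) = k"
        using assms(1) j by auto
    next
      fix e assume e: "e \<in> {e. e dvd m div j}"
      moreover obtain a where a: "m = j * a" using j by (elim dvdE)
      ultimately obtain b where b: "a = e * b" using j by (auto elim!: dvdE)
      show "m div e \<in> {k. k \<in> {k. k dvd m} \<and> j dvd k}" "m div (m div e) = e"
        using assms(1) unfolding a b by auto
    qed auto
    also have "\<dots> = (if m div j = 1 then 1 else 0)"
      using j assms(1) by (intro sum_moebius_divisors) (auto intro: dvd_div_eq_0_iff simp: div_greater_zero_iff dvd_imp_le)
    also have "m div j = 1 \<longleftrightarrow> j = m" using j assms(1) by (auto elim!: dvdE)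
    finally have "(\<Sum>k\<in>{k. k \<in> {k. k dvd m} \<and> j dvd k}. moebius (m div k)) = (if j = m then 1 else 0)" .
    then have "D j powi (\<Sum>k\<in>{k. k \<in> {k. k dvd m} \<and> j dvd k}. moebius (m div k))
        = (if j = m then D j else 1)"
      by simp
    then show "(\<Prod>k\<in>{k. k \<in> {k. k dvd m} \<and> j dvd k}. D j powi moebius (m div k))
        = (if j = m then D j else 1)"
      unfolding power_int_sum[OF assms(2)[OF j(1)]] .
  qed
  also have "\<dots> = D m" using fin by (simp add: prod.delta)
  finally show ?thesis .
qed

section \<open>Power sums and rationality\<close>

text \<open>
A monic polynomial over a field of characteristic 0 has its coefficients in a subfield if and only if all power sums of
its roots lie there. This replaces Galois descent and the theorem on symmetric functions.
\<close>

locale subfield_set =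
  fixes K :: "'a::field_char_0 set"
  assumes zero_closed [simp]: "0 \<in> K" and one_closed [simp]: "1 \<in> K"
    and add_closed [simp]: "x \<in> K \<Longrightarrow> y \<in> K \<Longrightarrow> x + y \<in> K"
    and mult_closed [simp]: "x \<in> K \<Longrightarrow> y \<in> K \<Longrightarrow> x * y \<in> K"
    and uminus_closed [simp]: "x \<in> K \<Longrightarrow> - x \<in> K"
    and inverse_closed [simp]: "x \<in> K \<Longrightarrow> inverse x \<in> K"
begin

lemma diff_closed [simp]: "x \<in> K \<Longrightarrow> y \<in> K \<Longrightarrow> x - y \<in> K"
  using add_closed[of x "- y"] by simp

lemma divide_closed [simp]: "x \<in> K \<Longrightarrow> y \<in> K \<Longrightarrow> x / y \<in> K"
  by (simp add: divide_inverse)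

lemma of_nat_closed [simp]: "of_nat k \<in> K"
  by (induction k) simp_all

lemma sum_closed: "(\<And>i. i \<in> A \<Longrightarrow> f i \<in> K) \<Longrightarrow> sum f A \<in> K"
  by (induction A rule: infinite_finite_induct) simp_all

lemma power_closed [simp]: "x \<in> K \<Longrightarrow> x ^ k \<in> K"
  by (induction k) simp_all

context
  fixes A :: "'b set" and r :: "'b \<Rightarrow> 'a" and P :: "'a poly"
  assumes fin: "finite A" and P: "P = (\<Prod>i\<in>A. [:- r i, 1:])"
begin

text \<open>
The coefficient of \<open>x^j\<close> in the sum of \<open>r\<^sub>i^k x P / (x - r\<^sub>i)\<close>. For \<open>k = 0\<close> this is \<open>x P'\<close>, and raising \<open>k\<close>
by one costs a power sum; this recursion contains all of Newton's identities.
\<close>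

definition shifted_sum :: "nat \<Rightarrow> nat \<Rightarrow> 'a" where
  "shifted_sum k j = (\<Sum>i\<in>A. r i ^ k * coeff (pCons 0 (\<Prod>i\<in>A - {i}. [:- r i, 1:])) j)"

lemma shifted_sum_0_right: "shifted_sum k 0 = 0"
  by (simp add: shifted_sum_def)

lemma shifted_sum_0_left: "shifted_sum 0 j = of_nat j * coeff P j"
proof (cases j)
  case (Suc l)
  have "shifted_sum 0 j = coeff (pderiv P) l"
    by (simp add: shifted_sum_def Suc P pderiv_prod coeff_sum pderiv_pCons)
  then show ?thesis by (simp add: coeff_pderiv Suc)
qed (simp add: shifted_sum_def)

lemma shifted_sum_rec: "shifted_sum k j = (\<Sum>i\<in>A. r i ^ k) * coeff P j + shifted_sum (Suc k) (Suc j)"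
proof -
  have "coeff (pCons 0 Q) j = coeff P j + r i * coeff Q j"
    if "i \<in> A" "Q = (\<Prod>i\<in>A - {i}. [:- r i, 1:])" for i Q
  proof -
    have "P = [:- r i, 1:] * Q" using that fin by (simp add: P prod.remove)
    then show ?thesis by simp
  qed
  then show ?thesis
    unfolding shifted_sum_def sum_distrib_right sum.distrib[symmetric]
    by (intro sum.cong) (simp_all add: algebra_simps)
qed

lemma degree_P: "degree P = card A"
  by (simp add: P degree_prod_sum_eq)

lemma coeff_card: "coeff P (card A) = 1"
  using lead_coeff_prod[of "\<lambda>i. [:- r i, 1:]" A] by (simp add: degree_P[symmetric] P[symmetric])

lemma shifted_sum_beyond: "card A < j \<Longrightarrow> shifted_sum k j = 0"
proof -
  assume "card A < j"
  then have "coeff (pCons 0 (\<Prod>i\<in>A - {i}. [:- r i, 1:])) j = 0" if "i \<in> A" for i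
    using that fin card_gt_0_iff[of A]
    by (intro coeff_eq_0) (auto simp: degree_pCons_eq_if degree_prod_sum_eq)
  then show ?thesis by (simp add: shifted_sum_def)
qed

text \<open>
At \<open>j = card A\<close> the recursion expresses the power sum through the previous row, because \<open>P\<close> is monic and
the row \<open>Suc k\<close> vanishes beyond the degree.
\<close>

lemma power_sums_closed:
  assumes "\<And>j. coeff P j \<in> K"
  shows "(\<Sum>i\<in>A. r i ^ k) \<in> K"
proof -
  have p: "(\<Sum>i\<in>A. r i ^ k) = shifted_sum k (card A)" for k
    using shifted_sum_rec[of k "card A"] by (simp add: shifted_sum_beyond coeff_card)
  have "\<forall>j. shifted_sum k j \<in> K"
  proof (induction k)
    case 0
    show ?case using assms by (simp add: shifted_sum_0_left)
  next
    case (Suc k)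
    have "shifted_sum (Suc k) j \<in> K" for j
    proof (cases j)
      case (Suc l)
      have "shifted_sum (Suc k) j = shifted_sum k l - shifted_sum k (card A) * coeff P l"
        using shifted_sum_rec[of k l] by (simp add: p Suc)
      then show ?thesis using Suc.IH assms by simp
    qed (simp add: shifted_sum_0_right)
    then show ?case ..
  qed
  then show ?thesis by (simp add: p)
qed

text \<open>
Read from the top coefficient downwards, the recursion for \<open>k = 0\<close> gives \<open>(j - card A) P\<^sub>j\<close> in terms of
higher coefficients and power sums; characteristic 0 permits the division.
\<close>

lemma coeffs_closed:
  assumes p: "\<And>k. (\<Sum>i\<in>A. r i ^ k) \<in> K"
  shows "coeff P j \<in> K"
proof -
  have "coeff P j \<in> K \<and> (\<forall>k. shifted_sum k j \<in> K)" if "Suc (card A) - j = n" for n j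
    using that
  proof (induction n arbitrary: j)
    case 0
    then show ?case by (simp add: shifted_sum_beyond coeff_eq_0 degree_P)
  next
    case (Suc n)
    then have IH: "shifted_sum k (Suc j) \<in> K" for k by simp
    have "coeff P j \<in> K"
    proof (cases "j = card A")
      case False
      then have "j < card A" using Suc.prems by simp
      then have ne: "of_nat j - of_nat (card A) \<noteq> (0::'a)" by simp
      have "(of_nat j - of_nat (card A)) * coeff P j = shifted_sum 1 (Suc j)"
        using shifted_sum_rec[of 0 j] by (simp add: shifted_sum_0_left algebra_simps)
      then have "coeff P j = shifted_sum 1 (Suc j) / (of_nat j - of_nat (card A))"
        using ne by (simp add: field_simps)
      then show ?thesis using IH by simp
    qed (simp add: coeff_card)
    then show ?case using p IH by (simp add: shifted_sum_rec[of _ j])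
  qed
  then show ?thesis by blast
qed

end

lemma sum_poly_over_roots_closed:
  assumes "finite A" "\<And>j. coeff (\<Prod>i\<in>A. [:- i, 1:]) j \<in> K" "\<And>j. coeff g j \<in> K"
  shows "(\<Sum>i\<in>A. poly g i) \<in> K"
proof -
  have "(\<Sum>i\<in>A. poly g i) = (\<Sum>j\<le>degree g. coeff g j * (\<Sum>i\<in>A. i ^ j))"
    unfolding poly_altdef sum_distrib_left by (rule sum.swap)
  also have "\<dots> \<in> K"
    using assms(3) power_sums_closed[OF assms(1) refl, of "\<lambda>i. i", OF assms(2)]
    by (intro sum_closed[of "{..degree g}"] mult_closed)
  finally show ?thesis .
qed

end

section \<open>Division by polynomials with unit leading coefficient\<close>

text \<open>
Division with remainder by a monic polynomial takes place over the smaller ring, and its remainder stays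
zero there. The argument for \<open>dvd_of_monic_dvd_multiple\<close> is the same, with denominators in place of a larger ring.
\<close>

lemma monic_dvd_of_hom:
  fixes hom :: "'r::idom \<Rightarrow> 'l::idom"
  assumes "inj_comm_ring_hom hom" "monic G" "map_poly hom F = map_poly hom G * q"
  obtains Q where "F = G * Q" "q = map_poly hom Q"
proof -
  interpret inj_comm_ring_hom hom by fact
  interpret H: map_poly_inj_comm_ring_hom hom ..
  have G: "G \<noteq> 0" using assms(2) by auto
  obtain Q R where QR: "pseudo_divmod F G = (Q, R)" by force
  from pseudo_divmod[OF G QR] have FQR: "F = G * Q + R" and R: "R = 0 \<or> degree R < degree G"
    using assms(2) by auto
  have *: "map_poly hom G * (q - map_poly hom Q) = map_poly hom R"
    using assms(3) by (simp add: FQR hom_distribs algebra_simps)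
  have "q - map_poly hom Q = 0"
  proof (rule ccontr)
    assume ne: "q - map_poly hom Q \<noteq> 0"
    then have "degree (map_poly hom R) = degree G + degree (q - map_poly hom Q)"
      using G by (simp flip: * add: degree_mult_eq)
    moreover have "R \<noteq> 0" using ne * G by auto
    ultimately show False using R by simp
  qed
  with * have "map_poly hom R = 0" by simp
  then have "R = 0" by simp
  with FQR \<open>q - _ = 0\<close> show ?thesis by (intro that[of Q]) auto
qed

lemma dvd_of_monic_dvd_multiple:
  fixes F G :: "'a::idom poly"
  assumes "monic G" "D \<noteq> 0" "smult D F = G * q"
  obtains Q where "F = G * Q"
proof -
  have G: "G \<noteq> 0" using assms(1) by auto
  obtain Q R where QR: "pseudo_divmod F G = (Q, R)" by force
  from pseudo_divmod[OF G QR] have FQR: "F = G * Q + R" and R: "R = 0 \<or> degree R < degree G"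
    using assms(1) by auto
  have *: "G * (q - smult D Q) = smult D R"
    using assms(3) by (simp add: FQR smult_add_right algebra_simps)
  have "q - smult D Q = 0"
  proof (rule ccontr)
    assume ne: "q - smult D Q \<noteq> 0"
    then have "degree (smult D R) = degree G + degree (q - smult D Q)"
      using G by (simp flip: * add: degree_mult_eq)
    moreover have "R \<noteq> 0" using ne * G by auto
    ultimately show False using R assms(2) by simp
  qed
  with * have "R = 0" using assms(2) by simp
  then show ?thesis using FQR by (intro that[of Q]) simp
qed

text \<open>
In \<open>p^m - q^m = (p - q) (\<dots>)\<close> the second factor has top coefficient \<open>m\<close>, hence is nonzero.
\<close>

lemma monic_power_inject:
  fixes p q :: "'a::{idom, ring_char_0} poly"
  assumes "monic p" "monic q" "p ^ m = q ^ m" "m \<ge> 1"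
  shows "p = q"
proof -
  have p0: "p \<noteq> 0" and q0: "q \<noteq> 0" using assms by auto
  have "m * degree p = m * degree q"
    using arg_cong[OF assms(3), of degree] by (simp add: degree_power_eq p0 q0)
  then have deg: "degree q = degree p" using assms(4) by simp
  define n where "n = (m - 1) * degree p"
  have one: "coeff (q ^ (m - Suc i) * p ^ i) n = 1" if "i < m" for i
  proof -
    have "degree (q ^ (m - Suc i) * p ^ i) = (m - Suc i) * degree p + i * degree p"
      using p0 q0 by (simp add: degree_mult_eq degree_power_eq deg)
    also have "\<dots> = n" using that by (simp add: n_def flip: add_mult_distrib)
    finally show ?thesis
      using assms(1,2) by (metis lead_coeff_mult lead_coeff_power power_one mult_1)
  qed
  have "(p - q) * (\<Sum>i<m. q ^ (m - Suc i) * p ^ i) = 0"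
    using power_diff_sumr2[of p m q] assms(3) by simp
  moreover have "coeff (\<Sum>i<m. q ^ (m - Suc i) * p ^ i) n = of_nat m"
    using one by (simp add: coeff_sum)
  then have "(\<Sum>i<m. q ^ (m - Suc i) * p ^ i) \<noteq> 0" using assms(4) by auto
  ultimately show ?thesis by simp
qed

lemma coeff_linear_product:
  fixes r :: "'b \<Rightarrow> 'a::comm_ring_1"
  assumes "finite A"
  shows "coeff (\<Prod>i\<in>A. [:- r i, 1:]) j = (\<Sum>S\<in>{S \<in> Pow A. card (A - S) = j}. \<Prod>i\<in>S. - r i)"
proof -
  have const: "(\<Prod>i\<in>S. [:- r i:]) = [:\<Prod>i\<in>S. - r i:]" for S
    by (induction S rule: infinite_finite_induct) (simp_all add: one_pCons)
  have "(\<Prod>i\<in>A. [:- r i, 1:]) = (\<Prod>i\<in>A. [:- r i:] + [:0, 1:])" by simp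
  also have "\<dots> = (\<Sum>S\<in>Pow A. (\<Prod>i\<in>S. [:- r i:]) * (\<Prod>i\<in>A - S. [:0, 1:]))"
    by (rule prod_add[OF assms])
  also have "\<dots> = (\<Sum>S\<in>Pow A. monom (\<Prod>i\<in>S. - r i) (card (A - S)))"
    by (simp add: const monom_altdef)
  finally have "coeff (\<Prod>i\<in>A. [:- r i, 1:]) j
      = (\<Sum>S\<in>Pow A. if card (A - S) = j then \<Prod>i\<in>S. - r i else 0)"
    by (simp add: coeff_sum)
  also have "\<dots> = (\<Sum>S\<in>{S \<in> Pow A. card (A - S) = j}. \<Prod>i\<in>S. - r i)"
    by (rule sum.inter_filter[symmetric]) (use assms in simp)
  finally show ?thesis .
qed

section \<open>Periodic points and their orbits\<close>

definition exact_period :: "('a \<Rightarrow> 'a) \<Rightarrow> nat \<Rightarrow> 'a set" where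
  "exact_period g k = {z. (g ^^ k) z = z \<and> (\<forall>j. 0 < j \<longrightarrow> j < k \<longrightarrow> (g ^^ j) z \<noteq> z)}"

text \<open>
The least positive period of a point divides every other one.
\<close>

lemma fixed_points_partition:
  assumes "m > 0"
  shows "{z. (g ^^ m) z = z} = (\<Union>k\<in>{k. k dvd m}. exact_period g k)"
proof (intro equalityI subsetI)
  fix z assume "z \<in> {z. (g ^^ m) z = z}"
  then have z: "(g ^^ m) z = z" by simp
  define k where "k = (LEAST k. 0 < k \<and> (g ^^ k) z = z)"
  have k: "0 < k \<and> (g ^^ k) z = z"
    unfolding k_def by (rule LeastI[of _ m]) (use assms z in simp)
  have least: "(g ^^ j) z \<noteq> z" if "0 < j" "j < k" for j
    using not_less_Least[of j "\<lambda>k. 0 < k \<and> (g ^^ k) z = z"] that by (auto simp: k_def)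
  have "(g ^^ (m mod k)) z = z" using funpow_mod_eq[where f = g and n = k and x = z and m = m] k z by simp
  then have "m mod k = 0" using least[of "m mod k"] k by (meson mod_less_divisor neq0_conv)
  then show "z \<in> (\<Union>k\<in>{k. k dvd m}. exact_period g k)"
    using k least by (auto simp: exact_period_def)
next
  fix z assume "z \<in> (\<Union>k\<in>{k. k dvd m}. exact_period g k)"
  then obtain k where k: "k dvd m" "(g ^^ k) z = z" by (auto simp: exact_period_def)
  then show "z \<in> {z. (g ^^ m) z = z}"
    using funpow_mod_eq[where f = g and n = k and x = z and m = m] by simp
qed

lemma exact_period_disjoint:
  assumes "0 < j" "0 < k" "j \<noteq> k"
  shows "exact_period g j \<inter> exact_period g k = {}"
  using assms by (auto simp: exact_period_def) (metis linorder_neqE_nat)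

definition orbit_of :: "('a \<Rightarrow> 'a) \<Rightarrow> nat \<Rightarrow> 'a \<Rightarrow> 'a set" where
  "orbit_of g m z = (\<lambda>i. (g ^^ i) z) ` {..<m}"

context
  fixes g :: "'a \<Rightarrow> 'a" and m :: nat
  assumes m: "m \<ge> 1"
begin

lemma exact_period_funpow_mult: "z \<in> exact_period g m \<Longrightarrow> (g ^^ (i * m)) z = z"
  using funpow_mod_eq[where f = g and n = m and x = z and m = "i * m"] by (simp add: exact_period_def)

lemma exact_period_return:
  assumes "z \<in> exact_period g m"
  shows "(g ^^ (i * m - i)) ((g ^^ i) z) = z"
proof -
  have "i * m - i + i = i * m" using m by simp
  then have "(g ^^ (i * m - i)) ((g ^^ i) z) = (g ^^ (i * m)) z"
    by (metis comp_apply funpow_add)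
  then show ?thesis using exact_period_funpow_mult[OF assms] by simp
qed

lemma funpow_commute: "(g ^^ i) ((g ^^ j) z) = (g ^^ j) ((g ^^ i) z)"
  by (metis add.commute comp_apply funpow_add)

lemma funpow_exact_period:
  assumes z: "z \<in> exact_period g m"
  shows "(g ^^ i) z \<in> exact_period g m"
  unfolding exact_period_def
proof (intro CollectI conjI allI impI notI)
  show "(g ^^ m) ((g ^^ i) z) = (g ^^ i) z"
    using exact_period_funpow_mult[OF z, of 1] funpow_commute[of m i z] by simp
next
  fix j assume j: "0 < j" "j < m" "(g ^^ j) ((g ^^ i) z) = (g ^^ i) z"
  then have "(g ^^ (i * m - i)) ((g ^^ i) ((g ^^ j) z)) = z"
    using exact_period_return[OF z] by (simp add: funpow_commute[of i j])
  then have "(g ^^ j) ((g ^^ (i * m - i)) ((g ^^ i) z)) = z"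
    by (simp only: funpow_commute[of j])
  then show False using exact_period_return[OF z] z j(1,2) by (simp add: exact_period_def)
qed

lemma inj_on_orbit:
  assumes z: "z \<in> exact_period g m"
  shows "inj_on (\<lambda>i. (g ^^ i) z) {..<m}"
proof (rule linorder_inj_onI)
  fix i j assume ij: "i < j" "j \<in> {..<m}"
  show "(g ^^ i) z \<noteq> (g ^^ j) z"
  proof
    assume "(g ^^ i) z = (g ^^ j) z"
    also have "\<dots> = (g ^^ (j - i)) ((g ^^ i) z)"
      using ij by (metis comp_apply funpow_add le_add_diff_inverse2 less_imp_le)
    finally have "(g ^^ (j - i)) ((g ^^ i) z) = (g ^^ i) z" by (rule sym)
    moreover have "(g ^^ (j - i)) ((g ^^ i) z) \<noteq> (g ^^ i) z"
      using funpow_exact_period[OF z, of i] ij by (simp add: exact_period_def)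
    ultimately show False by contradiction
  qed
qed auto

lemma orbit_of_eq_range:
  assumes z: "z \<in> exact_period g m"
  shows "orbit_of g m z = range (\<lambda>i. (g ^^ i) z)"
proof -
  have "(g ^^ i) z \<in> orbit_of g m z" for i
  proof -
    have "(g ^^ i) z = (g ^^ (i mod m)) z"
      using funpow_mod_eq[where f = g and n = m and x = z and m = i] z by (simp add: exact_period_def)
    moreover have "i mod m < m" using m by simp
    ultimately show ?thesis by (auto simp: orbit_of_def)
  qed
  then show ?thesis by (auto simp: orbit_of_def)
qed

lemma orbit_of_eq:
  assumes z: "z \<in> exact_period g m" and w: "w \<in> orbit_of g m z"
  shows "orbit_of g m w = orbit_of g m z"
proof -
  obtain i where i: "w = (g ^^ i) z" using w by (auto simp: orbit_of_def)
  have "(g ^^ j) w \<in> range (\<lambda>i. (g ^^ i) z)" for j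
    unfolding i by (metis comp_apply funpow_add rangeI)
  moreover have "(g ^^ j) z \<in> range (\<lambda>i. (g ^^ i) w)" for j
  proof -
    have "(g ^^ j) z = (g ^^ j) ((g ^^ (i * m - i)) w)"
      unfolding i exact_period_return[OF z] ..
    then show ?thesis by (metis comp_apply funpow_add rangeI)
  qed
  ultimately show ?thesis
    unfolding orbit_of_eq_range[OF z] orbit_of_eq_range[OF funpow_exact_period[OF z, of i, folded i]]
    by blast
qed

lemma orbit_of_properties:
  assumes "z \<in> exact_period g m"
  shows "finite (orbit_of g m z)" "card (orbit_of g m z) = m" "z \<in> orbit_of g m z"
    "orbit_of g m z \<subseteq> exact_period g m"
proof -
  show "finite (orbit_of g m z)" by (simp add: orbit_of_def)
  show "card (orbit_of g m z) = m"
    unfolding orbit_of_def by (simp add: card_image[OF inj_on_orbit[OF assms]])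
  show "z \<in> orbit_of g m z"
    unfolding orbit_of_def using m by (intro image_eqI[of _ _ 0]) auto
  show "orbit_of g m z \<subseteq> exact_period g m"
    using funpow_exact_period[OF assms] by (auto simp: orbit_of_def)
qed

lemma orbits_disjoint:
  assumes "z \<in> exact_period g m" "w \<in> exact_period g m"
    "orbit_of g m z \<noteq> orbit_of g m w"
  shows "orbit_of g m z \<inter> orbit_of g m w = {}"
  using orbit_of_eq[OF assms(1)] orbit_of_eq[OF assms(2)] assms(3) by blast

end

section \<open>The closure of the field of rational functions in c\<close>

type_synonym closure = "int poly fract alg_closure"

interpretation tc: integral_closure to_closure
  by unfold_locales (auto simp: to_closure_def)

interpretation tci: idom_hom to_closure ..

interpretation tcp: map_poly_inj_comm_ring_hom to_closure ..

definition param :: closure where "param = to_closure [:0, 1:]"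

definition quotient_field :: "closure set" where "quotient_field = range to_ac"

interpretation qf: subfield_set quotient_field
  by unfold_locales
    (auto simp: quotient_field_def image_iff intro: to_ac_add[symmetric] to_ac_mult[symmetric]
      to_ac_minus[symmetric] to_ac_inverse[symmetric] to_ac_0[symmetric] to_ac_1[symmetric])

lemma to_closure_in_quotient_field: "to_closure a \<in> quotient_field"
  by (simp add: to_closure_def quotient_field_def)

text \<open>
The ring \<open>\<int>[c]\<close> is integrally closed. Together with \<open>exists_preimage_poly\<close> this is how polynomials are shown
to have coefficients in \<open>\<int>[c]\<close>: integrality comes from the roots, rationality from symmetry.
\<close>

lemma integral_in_quotient_field:
  assumes "tc.integral x" "x \<in> quotient_field"
  obtains a where "x = to_closure a"
proof -
  obtain y where y: "x = to_ac y" using assms(2) by (auto simp: quotient_field_def)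
  obtain a b where ab: "y = Fract a b" "b \<noteq> 0" by (cases y)
  have "y * to_fract b = to_fract a" using ab by (simp add: Fract_conv_to_fract)
  then have "x * to_closure b = to_closure a" unfolding y to_closure_def by (metis to_ac_mult)
  then have "x \<in> range to_closure"
    using integrally_closed[OF tc.integral_closure_axioms assms(1)] ab(2) by blast
  then show ?thesis using that by blast
qed

section \<open>The dynamics of f\<close>

definition dyn_map :: "nat \<Rightarrow> closure \<Rightarrow> closure" where
  "dyn_map d z = z ^ (d + 1) + param * z"

definition derivative_at :: "nat \<Rightarrow> closure \<Rightarrow> closure" where
  "derivative_at d z = of_nat (d + 1) * z ^ d + param"

lemma poly_f_poly: "poly (map_poly to_closure (f_poly d)) z = dyn_map d z"
  by (simp add: f_poly_def dyn_map_def tcp.hom_add poly_monom param_def del: One_nat_def)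

lemma poly_pderiv_f_poly: "poly (map_poly to_closure (pderiv (f_poly d))) z = derivative_at d z"
  by (simp add: f_poly_def derivative_at_def pderiv_add pderiv_monom tcp.hom_add poly_monom param_def
      tc.hom_of_nat tc.hom_add)

lemma f_iter_Suc: "f_iter d (Suc k) = pcompose (f_poly d) (f_iter d k)"
  by (simp add: f_iter_def)

lemma poly_f_iter: "poly (map_poly to_closure (f_iter d k)) z = (dyn_map d ^^ k) z"
proof (induction k)
  case 0
  show ?case by (simp add: f_iter_def map_poly_pCons)
next
  case (Suc k)
  then show ?case by (simp add: f_iter_Suc tc.map_poly_pcompose poly_pcompose poly_f_poly)
qed

lemma multiplier_eq_prod: "multiplier d m z = (\<Prod>i<m. derivative_at d ((dyn_map d ^^ i) z))"
proof (induction m)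
  case 0
  show ?case by (simp add: multiplier_def f_iter_def pderiv_pCons)
next
  case (Suc m)
  then show ?case
    by (simp add: multiplier_def f_iter_Suc pderiv_pcompose tcp.hom_mult tc.map_poly_pcompose
        poly_pcompose poly_pderiv_f_poly poly_f_iter mult.commute)
qed

lemma f_poly_degree: "d \<ge> 1 \<Longrightarrow> degree (f_poly d) = d + 1"
  unfolding f_poly_def by (subst degree_add_eq_left) (auto simp: degree_monom_eq)

lemma f_poly_monic: "d \<ge> 1 \<Longrightarrow> monic (f_poly d)"
  by (simp add: f_poly_degree) (simp add: f_poly_def)

lemma f_iter_degree: "d \<ge> 1 \<Longrightarrow> degree (f_iter d k) = (d + 1) ^ k"
proof (induction k)
  case 0
  show ?case by (simp add: f_iter_def)
next
  case (Suc k)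
  then show ?case by (simp add: f_iter_Suc degree_pcompose f_poly_degree)
qed

lemma f_iter_monic: "d \<ge> 1 \<Longrightarrow> monic (f_iter d k)"
proof (induction k)
  case 0
  show ?case by (simp add: f_iter_def)
next
  case (Suc k)
  have "lead_coeff (f_iter d (Suc k)) = lead_coeff (f_poly d) * lead_coeff (f_iter d k) ^ degree (f_poly d)"
    unfolding f_iter_Suc by (rule lead_coeff_comp) (use f_iter_degree[OF Suc.prems, of k] in simp)
  then show ?case using Suc f_poly_monic by simp
qed

lemma degree_period_poly:
  assumes "d \<ge> 1" "k \<ge> 1"
  shows "degree (f_iter d k - [:0, 1:]) = (d + 1) ^ k"
proof -
  have "(d + 1) ^ 1 \<le> (d + 1) ^ k" using assms by (intro power_increasing) auto
  then have "degree (f_iter d k) > 1" using assms by (simp add: f_iter_degree)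
  then have "degree (f_iter d k + (- [:0, 1:])) = degree (f_iter d k)"
    by (intro degree_add_eq_left) simp
  then show ?thesis
    unfolding diff_conv_add_uminus using f_iter_degree[OF assms(1)] by (simp only:)
qed

lemma monic_period_poly:
  assumes "d \<ge> 1" "k \<ge> 1"
  shows "monic (f_iter d k - [:0, 1:])"
proof -
  have "(d + 1) ^ 1 \<le> (d + 1) ^ k" using assms by (intro power_increasing) auto
  then have "(d + 1) ^ k > 1" using assms by simp
  then show ?thesis
    using f_iter_monic[of d k] assms
    by (auto simp: degree_period_poly f_iter_degree coeff_pCons split: nat.split)
qed

lemma integral_of_fixed:
  assumes "d \<ge> 1" "k \<ge> 1" "(dyn_map d ^^ k) z = z"
  shows "tc.integral z"
  unfolding tc.integral_def
  using assms by (intro exI[of _ "f_iter d k - [:0, 1:]"] conjI monic_period_poly)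
    (simp_all add: tcp.hom_minus poly_f_iter)

section \<open>Periodic points are simple\<close>

text \<open>
Congruence modulo \<open>c\<close> in the ring of integral elements. The right-hand side is required to be integral, so
that congruences can be multiplied.
\<close>

definition cong_param :: "closure \<Rightarrow> closure \<Rightarrow> bool" where
  "cong_param a b \<longleftrightarrow> tc.integral b \<and> (\<exists>e. tc.integral e \<and> a = b + param * e)"

lemma integral_param: "tc.integral param"
  by (simp add: param_def tc.integral_hom)

lemma cong_param_mult:
  assumes "cong_param a b" "cong_param a' b'"
  shows "cong_param (a * a') (b * b')"
proof -
  obtain e e' where e: "tc.integral b" "tc.integral b'" "tc.integral e" "tc.integral e'"
    "a = b + param * e" "a' = b' + param * e'"
    using assms by (auto simp: cong_param_def)
  have "a * a' = b * b' + param * (b * e' + e * b' + param * (e * e'))"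
    by (simp add: e(5,6) algebra_simps)
  moreover have "tc.integral (b * e' + e * b' + param * (e * e'))"
    using e integral_param by (intro tc.integral_intros)
  ultimately show ?thesis using e tc.integral_mult by (auto simp: cong_param_def)
qed

lemma cong_param_prod:
  fixes k :: nat
  shows "(\<And>i. i < k \<Longrightarrow> cong_param (a i) (b i)) \<Longrightarrow> cong_param (\<Prod>i<k. a i) (\<Prod>i<k. b i)"
proof (induction k)
  case 0
  show ?case by (auto simp: cong_param_def intro: exI[of _ 0])
next
  case (Suc k)
  then show ?case by (auto simp: intro!: cong_param_mult)
qed

text \<open>
Let \<open>N = (d+1)^k\<close> and let \<open>S\<close> be the product of the points \<open>y\<^sub>i\<close> of the orbit. Multiplying the congruences
\<open>y\<^sub>i \<lambda>(y\<^sub>i) = (d+1) f(y\<^sub>i)\<close> modulo \<open>c\<close> along the orbit gives \<open>S = N S\<close> if the multiplier is 1, while multiplying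
\<open>\<lambda>(y\<^sub>i) = (d+1) y\<^sub>i^d\<close> gives \<open>1 = N S^d\<close>. Hence \<open>(1 - N)^d\<close> is \<open>c\<close> times an integral element, which must
lie in \<open>\<int>[c]\<close>; but \<open>c\<close> does not divide a nonzero integer.
\<close>

lemma multiplier_neq_1:
  assumes d: "d \<ge> 1" and k: "k \<ge> 1" and per: "(dyn_map d ^^ k) z = z"
  shows "multiplier d k z \<noteq> 1"
proof
  assume "multiplier d k z = 1"
  define y where "y = (\<lambda>i. (dyn_map d ^^ i) z)"
  have lam1: "(\<Prod>i<k. derivative_at d (y i)) = 1"
    using \<open>multiplier d k z = 1\<close> by (simp add: multiplier_eq_prod y_def)
  have "(dyn_map d ^^ k) (y i) = y i" for i
    unfolding y_def using per by (metis add.commute comp_apply funpow_add)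
  then have int: "tc.integral (y i)" for i using integral_of_fixed d k by blast
  have y_Suc: "y (Suc i) = dyn_map d (y i)" for i by (simp add: y_def)
  define S where "S = (\<Prod>i<k. y i)"
  have int_S: "tc.integral S" using int by (simp add: S_def tc.integral_prod)
  define N where "N = (d + 1) ^ k"
  \<comment> \<open>The shifted product is compared term by term, without dividing by \<open>y 0\<close>, which may vanish.\<close>
  have shift: "(\<Prod>i<k. y (Suc i)) = S"
  proof -
    obtain l where l: "k = Suc l" using k by (cases k) auto
    have "y k = y 0" using per by (simp add: y_def)
    then show ?thesis
      unfolding S_def l by (subst (2) prod.lessThan_Suc_shift) (simp add: mult.commute l)
  qed
  have "cong_param (y i * derivative_at d (y i)) (of_nat (d + 1) * y (Suc i))" for i
  proof -
    have "y i * derivative_at d (y i) = of_nat (d + 1) * y (Suc i) + param * (- (of_nat d * y i))"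
      by (simp add: y_Suc dyn_map_def derivative_at_def algebra_simps)
    then show ?thesis
      unfolding cong_param_def using int
      by (intro conjI exI[of _ "- (of_nat d * y i)"] tc.integral_intros)
  qed
  then have "cong_param (\<Prod>i<k. y i * derivative_at d (y i)) (\<Prod>i<k. of_nat (d + 1) * y (Suc i))"
    by (intro cong_param_prod)
  then have "cong_param S (of_nat N * S)"
    unfolding prod.distrib lam1 shift S_def[symmetric] N_def by simp
  then obtain e1 where e1: "tc.integral e1" "S = of_nat N * S + param * e1"
    by (auto simp: cong_param_def)
  have "cong_param (derivative_at d (y i)) (of_nat (d + 1) * y i ^ d)" for i
    unfolding cong_param_def derivative_at_def using int
    by (intro conjI exI[of _ 1] tc.integral_intros) simp_all
  then have "cong_param (\<Prod>i<k. derivative_at d (y i)) (\<Prod>i<k. of_nat (d + 1) * y i ^ d)"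
    by (intro cong_param_prod)
  then have "cong_param 1 (of_nat N * S ^ d)"
    unfolding lam1 prod.distrib S_def prod_power_distrib N_def by simp
  then obtain e2 where e2: "tc.integral e2" "1 = of_nat N * S ^ d + param * e2"
    by (auto simp: cong_param_def)
  define M :: closure where "M = 1 - of_nat N"
  have MS: "M * S = param * e1" using e1(2) by (simp add: M_def algebra_simps)
  define e where "e = of_nat N * (param ^ (d - 1) * e1 ^ d) + M ^ d * e2"
  have int_e: "tc.integral e"
    unfolding e_def M_def using e1 e2 integral_param by (intro tc.integral_intros)
  have "M ^ d = M ^ d * (of_nat N * S ^ d + param * e2)"
    using e2(2) by simp
  also have "\<dots> = of_nat N * (M * S) ^ d + param * (M ^ d * e2)"
    by (simp add: power_mult_distrib algebra_simps)
  also have "\<dots> = e * param"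
  proof -
    have "param ^ d = param * param ^ (d - 1)" using d by (simp flip: power_Suc)
    then show ?thesis unfolding MS by (simp add: e_def power_mult_distrib algebra_simps)
  qed
  finally have "e * to_closure [:0, 1:] = to_closure ((1 - of_nat N) ^ d)"
    by (simp add: M_def param_def tc.hom_power tc.hom_minus tc.hom_of_nat)
  then have "e \<in> range to_closure"
    using integrally_closed[OF tc.integral_closure_axioms int_e] by (metis pCons_eq_0_iff zero_neq_one)
  then obtain a where "e = to_closure a" by blast
  then have "to_closure (a * [:0, 1:]) = to_closure ((1 - of_nat N) ^ d)"
    using \<open>e * _ = _\<close> by (simp only: tc.hom_mult)
  then have "a * [:0, 1:] = (1 - of_nat N) ^ d" by simp
  then have "poly (a * [:0, 1:]) 0 = poly ((1 - of_nat N) ^ d) 0" by simp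
  then have "(1 - int N) ^ d = 0" by (simp add: poly_power)
  then have "N = 1" by simp
  moreover have "(d + 1) ^ 1 \<le> (d + 1) ^ k" using k by (intro power_increasing) auto
  ultimately show False using d by (simp add: N_def)
qed

section \<open>The dynatomic polynomial\<close>

definition fixed_points :: "nat \<Rightarrow> nat \<Rightarrow> closure set" where
  "fixed_points d k = {z. (dyn_map d ^^ k) z = z}"

abbreviation periodic_points :: "nat \<Rightarrow> nat \<Rightarrow> closure set" where
  "periodic_points d k \<equiv> exact_period (dyn_map d) k"

lemma prod_roots_of_rsquarefree:
  fixes p :: "'a::{alg_closed_field, field_char_0} poly"
  assumes "monic p" "rsquarefree p"
  shows "p = (\<Prod>z\<in>{z. poly p z = 0}. [:- z, 1:])"
proof -
  have p0: "p \<noteq> 0" using assms by auto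
  obtain A where A: "p = smult (lead_coeff p) (\<Prod>x\<in>#A. [:- x, 1:])"
    using alg_closed_imp_factorization[OF p0] by blast
  have pr: "proots (\<Prod>x\<in>#A. [:- x, 1:]) = A" for A :: "'a multiset"
  proof (induction A)
    case (add x A)
    have "(\<Prod>x\<in>#A. [:- x, 1:]) \<noteq> 0" by (auto simp: prod_mset_zero_iff)
    then show ?case using add by (simp add: proots_mult del: mult_pCons_left)
  qed simp
  have "proots p = A" using A assms(1) pr by simp
  moreover have "proots p = mset_set {z. poly p z = 0}"
  proof (rule multiset_eqI)
    fix z
    show "count (proots p) z = count (mset_set {z. poly p z = 0}) z"
      using assms(2)[unfolded rsquarefree_def, THEN conjunct2, rule_format, of z]
        p0 poly_roots_finite[OF p0] order_root[of p z]
      by (cases "poly p z = 0") auto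
  qed
  ultimately show ?thesis using A assms(1) by (simp add: prod_unfold_prod_mset)
qed

text \<open>
The derivative of \<open>f^k(z) - z\<close> at a root is the multiplier minus 1, so all roots are simple.
\<close>

lemma period_poly_factorization:
  assumes d: "d \<ge> 1" and k: "k \<ge> 1"
  shows "finite (fixed_points d k)"
    and "map_poly to_closure (f_iter d k - [:0, 1:]) = (\<Prod>z\<in>fixed_points d k. [:- z, 1:])"
proof -
  let ?F = "map_poly to_closure (f_iter d k - [:0, 1:])"
  have monic: "monic ?F" using monic_period_poly[OF d k] by simp
  have root: "poly ?F z = 0 \<longleftrightarrow> z \<in> fixed_points d k" for z
    by (simp add: tcp.hom_minus poly_f_iter fixed_points_def)
  have "rsquarefree ?F"
    unfolding rsquarefree_roots
  proof (intro allI notI)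
    fix z assume z: "poly ?F z = 0 \<and> poly (pderiv ?F) z = 0"
    have "poly (pderiv ?F) z = multiplier d k z - 1"
      by (simp add: tci.map_poly_pderiv[symmetric] multiplier_def pderiv_diff tcp.hom_minus pderiv_pCons)
    then show False
      using z root multiplier_neq_1[OF d k] by (auto simp: fixed_points_def)
  qed
  from prod_roots_of_rsquarefree[OF monic this]
  show "?F = (\<Prod>z\<in>fixed_points d k. [:- z, 1:])" by (simp add: root)
  have "?F \<noteq> 0" using monic by auto
  from poly_roots_finite[OF this] show "finite (fixed_points d k)" by (simp add: root)
qed

lemma card_fixed_points:
  assumes "d \<ge> 1" "k \<ge> 1"
  shows "card (fixed_points d k) = (d + 1) ^ k"
proof -
  have "degree (\<Prod>z\<in>fixed_points d k. [:- z, 1:]) = (d + 1) ^ k"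
    using degree_period_poly[OF assms]
    by (simp flip: period_poly_factorization(2)[OF assms])
  then show ?thesis by (simp add: degree_prod_sum_eq)
qed

lemma fixed_points_Union:
  "m \<ge> 1 \<Longrightarrow> fixed_points d m = (\<Union>k\<in>{k. k dvd m}. periodic_points d k)"
  using fixed_points_partition[of m "dyn_map d"] by (simp add: fixed_points_def)

lemma finite_periodic_points:
  assumes "d \<ge> 1" "k \<ge> 1"
  shows "finite (periodic_points d k)"
  using period_poly_factorization(1)[OF assms]
  by (rule rev_finite_subset) (auto simp: fixed_points_def exact_period_def)

lemma prod_fixed_points:
  fixes g :: "closure \<Rightarrow> 'a::comm_monoid_mult"
  assumes "d \<ge> 1" "m \<ge> 1"
  shows "(\<Prod>z\<in>fixed_points d m. g z) = (\<Prod>k | k dvd m. \<Prod>z\<in>periodic_points d k. g z)"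
proof -
  have pos: "k \<ge> 1" if "k dvd m" for k using that assms(2) by (cases k) auto
  show ?thesis
    unfolding fixed_points_Union[OF assms(2)]
  proof (rule prod.UNION_disjoint)
    show "\<forall>k\<in>{k. k dvd m}. finite (periodic_points d k)"
      using finite_periodic_points[OF assms(1)] pos by blast
    show "\<forall>j\<in>{k. k dvd m}. \<forall>k\<in>{k. k dvd m}. j \<noteq> k \<longrightarrow> periodic_points d j \<inter> periodic_points d k = {}"
    proof (intro ballI impI)
      fix j k assume "j \<in> {k. k dvd m}" "k \<in> {k. k dvd m}" "j \<noteq> k"
      then show "periodic_points d j \<inter> periodic_points d k = {}"
        using pos[of j] pos[of k] by (intro exact_period_disjoint) auto
    qed
  qed (use assms in simp)
qed

lemma card_fixed_points_eq_sum:
  assumes "d \<ge> 1" "m \<ge> 1"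
  shows "(d + 1) ^ m = (\<Sum>k | k dvd m. card (periodic_points d k))"
proof -
  have pos: "k \<ge> 1" if "k dvd m" for k using that assms(2) by (cases k) auto
  have "card (fixed_points d m) = (\<Sum>k | k dvd m. card (periodic_points d k))"
    unfolding fixed_points_Union[OF assms(2)]
  proof (rule card_UN_disjoint)
    show "\<forall>k\<in>{k. k dvd m}. finite (periodic_points d k)"
      using finite_periodic_points[OF assms(1)] pos by blast
    show "\<forall>j\<in>{k. k dvd m}. \<forall>k\<in>{k. k dvd m}. j \<noteq> k \<longrightarrow> periodic_points d j \<inter> periodic_points d k = {}"
    proof (intro ballI impI)
      fix j k assume "j \<in> {k. k dvd m}" "k \<in> {k. k dvd m}" "j \<noteq> k"
      then show "periodic_points d j \<inter> periodic_points d k = {}"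
        using pos[of j] pos[of k] by (intro exact_period_disjoint) auto
    qed
  qed (use assms in simp)
  then show ?thesis using card_fixed_points[OF assms] by simp
qed

lemma dvd_card_periodic_points:
  assumes "d \<ge> 1" "m \<ge> 1"
  shows "d + 1 dvd card (periodic_points d m)"
  using assms(2)
proof (induction m rule: less_induct)
  case (less m)
  have fin: "finite {k. k dvd m}" using less.prems by simp
  have "(d + 1) ^ m = card (periodic_points d m) + (\<Sum>k\<in>{k. k dvd m} - {m}. card (periodic_points d k))"
    unfolding card_fixed_points_eq_sum[OF assms(1) less.prems] by (rule sum.remove[OF fin]) simp
  moreover have "d + 1 dvd (\<Sum>k\<in>{k. k dvd m} - {m}. card (periodic_points d k))"
  proof (rule dvd_sum)
    fix k assume "k \<in> {k. k dvd m} - {m}"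
    then show "d + 1 dvd card (periodic_points d k)"
      using less.prems by (intro less.IH) (auto intro: dvd_imp_le le_neq_trans Suc_leI dvd_pos_nat)
  qed
  moreover have "d + 1 dvd (d + 1) ^ m" using less.prems by (simp add: dvd_power)
  ultimately show ?case by (metis dvd_add_left_iff)
qed

lemma sum_card_periodic_points_div:
  assumes "d \<ge> 1" "m \<ge> 1"
  shows "(\<Sum>k | k dvd m. card (periodic_points d k) div (d + 1)) = (d + 1) ^ (m - 1)"
proof -
  have "(d + 1) * (\<Sum>k | k dvd m. card (periodic_points d k) div (d + 1))
      = (\<Sum>k | k dvd m. card (periodic_points d k))"
    unfolding sum_distrib_left
  proof (intro sum.cong refl dvd_mult_div_cancel dvd_card_periodic_points assms(1))
    fix k assume "k \<in> {k. k dvd m}"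
    then show "k \<ge> 1" using assms(2) by (cases k) auto
  qed
  also have "\<dots> = (d + 1) * (d + 1) ^ (m - 1)"
    using assms by (simp add: card_fixed_points_eq_sum[symmetric] flip: power_Suc)
  finally show ?thesis by (subst (asm) mult_cancel1) simp
qed

lemma monic_of_map_poly_prod:
  assumes "map_poly to_closure Q = (\<Prod>z\<in>A. [:- r z, 1:])"
  shows "monic Q"
proof -
  have "to_closure (lead_coeff Q) = lead_coeff (map_poly to_closure Q)" by simp
  also have "\<dots> = 1" unfolding assms by (subst lead_coeff_prod) simp
  finally show ?thesis by simp
qed

text \<open>
A family of products over all fixed points of the iterates descends to the points of exact period, by induction and
division by the monic product that belongs to the proper divisors. It is used with \<open>r z = z\<close> for
the dynatomic polynomial and with \<open>r z = \<lambda>(z)\<close> for the derivatives.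
\<close>

lemma exact_factor_exists:
  fixes r :: "closure \<Rightarrow> closure"
  assumes d: "d \<ge> 1"
    and F: "\<And>m. m \<ge> 1 \<Longrightarrow> \<exists>F. map_poly to_closure F = (\<Prod>z\<in>fixed_points d m. [:- r z, 1:])"
    and m: "m \<ge> 1"
  shows "\<exists>Q. map_poly to_closure Q = (\<Prod>z\<in>periodic_points d m. [:- r z, 1:])"
  using m
proof (induction m rule: less_induct)
  case (less m)
  have fin: "finite {k. k dvd m}" using less.prems by simp
  have "\<exists>Q. map_poly to_closure Q = (\<Prod>z\<in>periodic_points d k. [:- r z, 1:])"
    if "k \<in> {k. k dvd m} - {m}" for k
    using that less.prems by (intro less.IH) (auto intro: dvd_imp_le le_neq_trans Suc_leI dvd_pos_nat)
  then obtain Q where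
    Q: "\<And>k. k \<in> {k. k dvd m} - {m} \<Longrightarrow> map_poly to_closure (Q k) = (\<Prod>z\<in>periodic_points d k. [:- r z, 1:])"
    by metis
  define G where "G = (\<Prod>k\<in>{k. k dvd m} - {m}. Q k)"
  have G: "map_poly to_closure G = (\<Prod>k\<in>{k. k dvd m} - {m}. \<Prod>z\<in>periodic_points d k. [:- r z, 1:])"
    unfolding G_def tcp.hom_prod by (intro prod.cong refl Q)
  have "monic G"
    unfolding G_def using Q monic_of_map_poly_prod by (auto simp: lead_coeff_prod intro!: prod.neutral)
  obtain F0 where F0: "map_poly to_closure F0 = (\<Prod>z\<in>fixed_points d m. [:- r z, 1:])"
    using F less.prems by blast
  have "map_poly to_closure F0 = map_poly to_closure G * (\<Prod>z\<in>periodic_points d m. [:- r z, 1:])"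
    unfolding F0 prod_fixed_points[OF d less.prems] G
    by (subst prod.remove[OF fin, of m]) (simp_all add: mult.commute)
  from monic_dvd_of_hom[OF tc.inj_comm_ring_hom_axioms \<open>monic G\<close> this] show ?case by metis
qed

lemma dynatomic_factorization:
  assumes d: "d \<ge> 1" and m: "m \<ge> 1"
  shows "map_poly to_closure (dynatomic d m) = (\<Prod>z\<in>periodic_points d m. [:- z, 1:])"
proof -
  have "\<exists>Q. map_poly to_closure Q = (\<Prod>z\<in>periodic_points d k. [:- z, 1:])" if "k \<ge> 1" for k
    using exact_factor_exists[OF d, of "\<lambda>z. z"] period_poly_factorization(2)[OF d] that by blast
  then obtain Q where Q: "\<And>k. k \<ge> 1 \<Longrightarrow> map_poly to_closure (Q k) = (\<Prod>z\<in>periodic_points d k. [:- z, 1:])"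
    by metis
  have pos: "k \<ge> 1" if "k dvd m" for k using that m by (cases k) auto
  have F: "f_iter d k - [:0, 1:] = (\<Prod>j | j dvd k. Q j)" if "k \<ge> 1" for k
  proof -
    have "map_poly to_closure (f_iter d k - [:0, 1:]) = map_poly to_closure (\<Prod>j | j dvd k. Q j)"
      unfolding period_poly_factorization(2)[OF d that] prod_fixed_points[OF d that] tcp.hom_prod
      using that by (intro prod.cong refl Q[symmetric]) (auto intro: dvd_pos_nat Suc_leI)
    then show ?thesis by simp
  qed
  have to_fract_prod: "to_fract (\<Prod>j\<in>A. Q j) = (\<Prod>j\<in>A. to_fract (Q j))" for A :: "nat set"
    by (induction A rule: infinite_finite_induct) simp_all
  have "(\<Prod>k | k dvd m. to_fract (f_iter d k - [:0, 1:]) powi moebius (m div k)) = to_fract (Q m)"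
  proof (rule multiplicative_moebius_inversion)
    show "m > 0" using m by simp
    fix k assume k: "k dvd m"
    have "monic (Q k)" using Q[OF pos[OF k]] by (rule monic_of_map_poly_prod)
    then show "to_fract (Q k) \<noteq> 0" by auto
    show "to_fract (f_iter d k - [:0, 1:]) = (\<Prod>j | j dvd k. to_fract (Q j))"
      unfolding F[OF pos[OF k]] to_fract_prod ..
  qed
  then have "dynatomic d m = Q m" unfolding dynatomic_def by (intro the_equality) auto
  then show ?thesis using Q[OF m] by simp
qed

lemma degree_dynatomic:
  assumes d: "d \<ge> 1" and m: "m \<ge> 1"
  shows "degree (dynatomic d m) = card (periodic_points d m)"
proof -
  have "degree (map_poly to_closure (dynatomic d m)) = card (periodic_points d m)"
    unfolding dynatomic_factorization[OF assms] by (simp add: degree_prod_sum_eq)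
  then show ?thesis by simp
qed

lemma proots_dynatomic:
  assumes d: "d \<ge> 1" and m: "m \<ge> 1"
  shows "proots (map_poly to_closure (dynatomic d m)) = mset_set (periodic_points d m)"
proof -
  have "proots (\<Prod>z\<in>A. [:- z, 1:]) = mset_set A" if "finite A" for A :: "closure set"
    using that by (induction A rule: finite_induct)
      (auto simp: proots_mult simp del: mult_pCons_left)
  then show ?thesis
    unfolding dynatomic_factorization[OF assms] using finite_periodic_points[OF assms] by blast
qed

section \<open>Substituting d c for the variable t\<close>

interpretation const_int: inj_comm_ring_hom "\<lambda>n::int. [:n:]"
  by unfold_locales (auto simp: one_pCons)

interpretation const_coeffs: map_poly_inj_comm_ring_hom "\<lambda>n::int. [:n:]" ..

interpretation const_coeffs_poly: map_poly_inj_comm_ring_hom "map_poly (\<lambda>n::int. [:n:])" ..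

lemma subst_t_add: "subst_t (P + Q) a = subst_t P a + subst_t Q a"
  by (simp add: subst_t_def const_coeffs_poly.hom_add)

lemma subst_t_diff: "subst_t (P - Q) a = subst_t P a - subst_t Q a"
  by (simp add: subst_t_def const_coeffs_poly.hom_minus)

lemma subst_t_mult: "subst_t (P * Q) a = subst_t P a * subst_t Q a"
  by (simp add: subst_t_def const_coeffs_poly.hom_mult)

lemma subst_t_power: "subst_t (P ^ n) a = subst_t P a ^ n"
  by (simp add: subst_t_def const_coeffs_poly.hom_power)

lemma subst_t_of_nat: "subst_t (of_nat n) a = of_nat n"
  by (simp add: subst_t_def const_coeffs_poly.hom_of_nat)

lemma subst_t_prod: "subst_t (\<Prod>i\<in>A. P i) a = (\<Prod>i\<in>A. subst_t (P i) a)"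
  by (simp add: subst_t_def const_coeffs_poly.hom_prod poly_prod)

lemma subst_t_pCons: "subst_t (pCons q P) a = map_poly (\<lambda>n. [:n:]) q + [:a:] * subst_t P a"
  by (simp add: subst_t_def const_coeffs.map_poly_pCons_hom)

lemma subst_t_0: "subst_t 0 a = 0"
  by (simp add: subst_t_def)

text \<open>
The coefficient of \<open>x^j\<close> as a polynomial in \<open>t\<close>: elements of \<open>\<int>[x][t]\<close> have \<open>t\<close> as their outer variable, and
their image under the substitution has \<open>x\<close> as outer variable.
\<close>

definition column :: "int poly poly \<Rightarrow> nat \<Rightarrow> int poly" where
  "column P j = map_poly (\<lambda>q. coeff q j) P"

lemma coeff_column: "coeff (column P j) i = coeff (coeff P i) j"
  by (simp add: column_def coeff_map_poly)

lemma coeff_subst_t: "coeff (subst_t P a) j = pcompose (column P j) a"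
proof (induction P)
  case 0
  show ?case by (simp add: subst_t_0 column_def)
next
  case (pCons q P)
  then show ?case
    by (simp add: subst_t_pCons column_def map_poly_pCons pcompose_pCons coeff_map_poly)
qed

lemma subst_t_inject:
  assumes "degree a > 0" "subst_t P a = subst_t Q a"
  shows "P = Q"
proof -
  have "subst_t (P - Q) a = 0" using assms by (simp add: subst_t_diff)
  then have "pcompose (column (P - Q) j) a = 0" for j by (simp flip: coeff_subst_t)
  then have "column (P - Q) j = 0" for j using pcompose_eq_0[OF _ assms(1)] by blast
  then have "coeff (coeff (P - Q) i) j = 0" for i j by (metis coeff_column coeff_0)
  then have "P - Q = 0" by (simp add: poly_eq_iff)
  then show ?thesis by simp
qed

lemma exists_with_columns:
  assumes "\<And>j. j > M \<Longrightarrow> g j = 0"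
  obtains P where "\<And>j. column P j = g j"
proof -
  define P where "P = (\<Sum>j\<le>M. map_poly (\<lambda>n. monom n j) (g j))"
  have "coeff (coeff P i) j = coeff (g j) i" for i j
  proof -
    have "coeff (coeff P i) j = (\<Sum>l\<le>M. if l = j then coeff (g l) i else 0)"
      by (simp add: P_def coeff_sum coeff_map_poly)
    then show ?thesis using assms[of j] by (cases "j \<le> M") simp_all
  qed
  then show ?thesis by (intro that[of P]) (simp add: poly_eq_iff coeff_column)
qed

lemma coeff_pcompose_scale: "coeff (pcompose p [:0, e:]) i = e ^ i * coeff (p :: 'a::comm_ring_1 poly) i"
  using coeff_pcompose_monom_linear[of p e i] by (simp add: monom_Suc monom_0)

lemma scaled_in_range_pcompose:
  assumes "degree a \<le> N"
  obtains g where "pcompose g [:0, of_nat d:] = smult (of_nat d ^ N) (a :: int poly)"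
proof -
  define g where "g = Poly (map (\<lambda>i. of_nat d ^ (N - i) * coeff a i) [0..<Suc N])"
  have g: "coeff g i = (if i \<le> N then of_nat d ^ (N - i) * coeff a i else 0)" for i
    by (auto simp: g_def nth_default_def nth_append simp del: upt_Suc)
  have "pcompose g [:0, of_nat d:] = smult (of_nat d ^ N) a"
  proof (rule poly_eqI)
    fix i
    show "coeff (pcompose g [:0, of_nat d:]) i = coeff (smult (of_nat d ^ N) a) i"
    proof (cases "i \<le> N")
      case True
      then have "of_nat d ^ N = of_nat d ^ i * (of_nat d ^ (N - i) :: int)"
        by (simp flip: power_add)
      then show ?thesis using True by (simp add: coeff_pcompose_scale g)
    next
      case False
      then show ?thesis using assms by (simp add: coeff_pcompose_scale g coeff_eq_0)
    qed
  qed
  then show ?thesis by (rule that)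
qed

text \<open>
Since \<open>c = t/d\<close>, a power of \<open>d\<close> clears the denominators that arise when \<open>c\<close> is eliminated. Its exponent
may be arbitrary, since \<open>dvd_of_unit_lead_dvd_multiple\<close> cancels it.
\<close>

lemma scaled_in_range_subst_t:
  obtains N A where "subst_t A [:0, of_nat d:] = smult (of_nat d ^ N) q"
proof -
  define N where "N = Max (insert 0 ((\<lambda>j. degree (coeff q j)) ` {..degree q}))"
  have "degree (coeff q j) \<le> N" for j
  proof (cases "j \<le> degree q")
    case True
    then show ?thesis by (auto simp: N_def)
  qed (simp add: coeff_eq_0)
  then have "\<exists>g. pcompose g [:0, of_nat d:] = smult (of_nat d ^ N) (coeff q j)" for j
    by (metis scaled_in_range_pcompose)
  then obtain g where g: "\<And>j. pcompose (g j) [:0, of_nat d:] = smult (of_nat d ^ N) (coeff q j)"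
    by metis
  obtain P where P: "\<And>j. column P j = (if j \<le> degree q then g j else 0)"
    by (rule exists_with_columns[of "degree q" "\<lambda>j. if j \<le> degree q then g j else 0"]) auto
  have "subst_t P [:0, of_nat d:] = smult (of_nat d ^ N) q"
  proof (rule poly_eqI)
    fix j
    have "smult (of_nat d ^ N) (coeff q j) = of_nat d ^ N * coeff q j"
      by (simp add: of_nat_poly poly_const_pow)
    then show "coeff (subst_t P [:0, of_nat d:]) j = coeff (smult (of_nat d ^ N) q) j"
      by (simp add: coeff_subst_t P g coeff_eq_0)
  qed
  then show ?thesis by (rule that)
qed

section \<open>Evaluation at t = d c\<close>

definition eval_param :: "nat \<Rightarrow> int poly poly \<Rightarrow> closure \<Rightarrow> closure" where
  "eval_param d P x = poly (map_poly to_closure (subst_t P [:0, of_nat d:])) x"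

lemma eval_param_add: "eval_param d (P + Q) x = eval_param d P x + eval_param d Q x"
  by (simp add: eval_param_def subst_t_add tcp.hom_add)

lemma eval_param_diff: "eval_param d (P - Q) x = eval_param d P x - eval_param d Q x"
  by (simp add: eval_param_def subst_t_diff tcp.hom_minus)

lemma eval_param_mult: "eval_param d (P * Q) x = eval_param d P x * eval_param d Q x"
  by (simp add: eval_param_def subst_t_mult tcp.hom_mult)

lemma eval_param_power: "eval_param d (P ^ n) x = eval_param d P x ^ n"
  by (simp add: eval_param_def subst_t_power tcp.hom_power)

lemma eval_param_prod: "eval_param d (\<Prod>i\<in>A. P i) x = (\<Prod>i\<in>A. eval_param d (P i) x)"
  by (simp add: eval_param_def subst_t_prod tcp.hom_prod poly_prod)

lemma eval_param_of_nat: "eval_param d (of_nat n) x = of_nat n"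
  by (simp add: eval_param_def subst_t_of_nat tcp.hom_of_nat)

lemma to_closure_scale: "to_closure [:0, of_nat d:] = of_nat d * param"
proof -
  have "[:0, of_nat d:] = of_nat d * [:0, 1 :: int:]"
    unfolding of_nat_poly by simp
  then show ?thesis by (simp only: tc.hom_mult tc.hom_of_nat param_def)
qed

lemma eval_param_t: "eval_param d [:0, 1:] x = of_nat d * param"
  by (simp add: eval_param_def subst_t_pCons subst_t_0 tc.map_poly_pCons_hom to_closure_scale)

lemma eval_param_x: "eval_param d [:[:0, 1:]:] x = x"
  by (simp add: eval_param_def subst_t_pCons subst_t_0 const_int.map_poly_pCons_hom tc.map_poly_pCons_hom)

lemmas eval_param_simps = eval_param_add eval_param_diff eval_param_mult eval_param_power
  eval_param_prod eval_param_of_nat eval_param_t eval_param_x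

section \<open>The ratio of f(z) to z\<close>

text \<open>
The iterates of \<open>U(u) = u^(d+1) + c (1 - u^d)\<close>, the map that \<open>f\<close> induces on the ratio \<open>u = f(z)/z = z^d + c\<close>.
\<close>

fun ratio_iterate :: "nat \<Rightarrow> closure \<Rightarrow> nat \<Rightarrow> closure" where
  "ratio_iterate d u 0 = u"
| "ratio_iterate d u (Suc i) =
    ratio_iterate d u i ^ (d + 1) + param * (1 - ratio_iterate d u i ^ d)"

lemma ratio_iterate_dynamics:
  assumes "u = z ^ d + param"
  shows "(dyn_map d ^^ k) z = z * (\<Prod>i<k. ratio_iterate d u i)"
    and "ratio_iterate d u k = ((dyn_map d ^^ k) z) ^ d + param"
proof -
  have "(dyn_map d ^^ k) z = z * (\<Prod>i<k. ratio_iterate d u i) \<and>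
      ratio_iterate d u k = ((dyn_map d ^^ k) z) ^ d + param"
  proof (induction k)
    case 0
    show ?case by (simp add: assms)
  next
    case (Suc k)
    define y r where "y = (dyn_map d ^^ k) z" and "r = ratio_iterate d u k"
    have r: "r = y ^ d + param" using Suc by (simp add: y_def r_def)
    have next_y: "(dyn_map d ^^ Suc k) z = y * r"
      by (simp add: dyn_map_def y_def[symmetric] r algebra_simps)
    have "ratio_iterate d u (Suc k) = (y * r) ^ d + param"
    proof -
      have "ratio_iterate d u (Suc k) = (r - param) * r ^ d + param"
        by (simp add: r_def[symmetric] algebra_simps)
      then show ?thesis by (simp add: r power_mult_distrib)
    qed
    then show ?case
      using Suc next_y by (simp add: y_def[symmetric] r_def[symmetric] mult.assoc)
  qed
  then show "(dyn_map d ^^ k) z = z * (\<Prod>i<k. ratio_iterate d u i)"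
    and "ratio_iterate d u k = ((dyn_map d ^^ k) z) ^ d + param" by auto
qed

text \<open>
For each \<open>d\<close>-th root \<open>\<rho>\<close> of \<open>w\<close>, the product of \<open>\<rho> - z\<close> over the fixed points \<open>z\<close> of \<open>f^m\<close> is
\<open>f^m(\<rho>) - \<rho>\<close>, that is \<open>\<rho>\<close> times the product of the first \<open>m\<close> ratios minus \<open>\<rho>\<close>. The ratios depend only on
\<open>\<rho>^d = w\<close>, so multiplying over all \<open>\<rho>\<close> removes the roots. The signs cancel, as \<open>((d+1)^m + 1) (d+1)\<close> is even.
\<close>

lemma prod_fixed_points_minus_power:
  assumes d: "d \<ge> 1" and m: "m \<ge> 1"
  shows "(\<Prod>z\<in>fixed_points d m. w - z ^ d)
    = w * ((\<Prod>i<m. ratio_iterate d (w + param) i) - 1) ^ d"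
proof -
  let ?n = "(d + 1) ^ m"
  define p where "p = monom 1 d + [:- w:]"
  have deg: "degree p = d" unfolding p_def using d by (subst degree_add_eq_left) (auto simp: degree_monom_eq)
  then have "lead_coeff p = 1" using d by (simp add: p_def coeff_pCons split: nat.split)
  moreover have "p \<noteq> 0" using deg d by auto
  ultimately obtain A where A: "size A = d" "p = (\<Prod>x\<in>#A. [:- x, 1:])"
    using alg_closed_imp_factorization[of p] deg by auto
  have poly_p: "poly p z = z ^ d - w" for z by (simp add: p_def poly_monom)
  have poly_A: "poly p z = (\<Prod>x\<in>#A. z - x)" for z
    unfolding A(2) by (induction A) (simp_all add: algebra_simps)
  have root: "x ^ d = w" if "x \<in># A" for x
  proof -
    obtain B where "A = add_mset x B" using \<open>x \<in># A\<close> by (metis multi_member_split)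
    then show ?thesis using poly_A[of x] by (simp add: poly_p)
  qed
  \<comment> \<open>Evaluation of the factorization of \<open>z^d - w\<close> at 0.\<close>
  have prod_A: "(\<Prod>x\<in>#A. x) = (- 1) ^ (d + 1) * w"
  proof -
    have "(\<Prod>x\<in>#B. 0 - x) = (- 1) ^ size B * (\<Prod>x\<in>#B. x)" for B :: "closure multiset"
      by (induction B) auto
    then have "- w = (- 1) ^ d * (\<Prod>x\<in>#A. x)"
      using poly_A[of 0] A(1) d by (simp add: poly_p power_0_left)
    then have "(- 1) ^ d * - w = (- 1) ^ d * ((- 1) ^ d * (\<Prod>x\<in>#A. x))" by simp
    then show ?thesis by (simp flip: mult.assoc power_mult_distrib)
  qed
  define R where "R = (\<Prod>i<m. ratio_iterate d (w + param) i) - 1"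
  have inner: "(\<Prod>z\<in>fixed_points d m. z - x) = (- 1) ^ ?n * (x * R)" if "x \<in># A" for x
  proof -
    have "(\<Prod>z\<in>fixed_points d m. x - z) = poly (map_poly to_closure (f_iter d m - [:0, 1:])) x"
      by (simp add: period_poly_factorization(2)[OF assms] poly_prod)
    also have "\<dots> = (dyn_map d ^^ m) x - x"
      by (simp add: tcp.hom_minus poly_f_iter)
    also have "\<dots> = x * R"
      using ratio_iterate_dynamics(1)[of "w + param" x d m] root[OF that]
      by (simp add: R_def algebra_simps)
    finally have "(\<Prod>z\<in>fixed_points d m. - (x - z)) = (- 1) ^ card (fixed_points d m) * (x * R)"
      by (simp only: prod_uminus)
    then show ?thesis by (simp add: card_fixed_points[OF assms])
  qed
  have "(\<Prod>z\<in>fixed_points d m. w - z ^ d) = (\<Prod>z\<in>fixed_points d m. - poly p z)"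
    by (simp add: poly_p)
  also have "\<dots> = (- 1) ^ ?n * (\<Prod>z\<in>fixed_points d m. \<Prod>x\<in>#A. z - x)"
    by (simp add: prod_uminus card_fixed_points[OF assms] poly_A)
  also have "(\<Prod>z\<in>fixed_points d m. \<Prod>x\<in>#A. z - x) = (\<Prod>x\<in>#A. \<Prod>z\<in>fixed_points d m. z - x)"
    by (induction A) (auto simp: prod.distrib)
  also have "\<dots> = (\<Prod>x\<in>#A. (- 1) ^ ?n * (x * R))"
    by (intro arg_cong[where f = prod_mset] image_mset_cong inner)
  also have "\<dots> = ((- 1) ^ ?n * R) ^ d * (\<Prod>x\<in>#A. x)"
  proof -
    have "(\<Prod>x\<in>#B. s * (x * R)) = (s * R) ^ size B * (\<Prod>x\<in>#B. x)" for s and B :: "closure multiset"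
      by (induction B) (simp_all add: mult_ac)
    then show ?thesis by (simp only: A(1))
  qed
  also have "(- 1) ^ ?n * (((- 1) ^ ?n * R) ^ d * (\<Prod>x\<in>#A. x)) = (- 1) ^ ((?n + 1) * (d + 1)) * (w * R ^ d)"
  proof -
    have "s * ((s * R) ^ d * (e * w)) = s ^ (d + 1) * e * (w * R ^ d)" for s e
      by (simp add: power_mult_distrib mult_ac)
    moreover have "(- 1 :: closure) ^ ((?n + 1) * (d + 1)) = ((- 1) ^ ?n) ^ (d + 1) * (- 1) ^ (d + 1)"
      by (simp only: power_mult[of "- 1 :: closure" "?n + 1" "d + 1"] power_add[of "- 1 :: closure" ?n 1]
          power_one_right power_mult_distrib)
    ultimately show ?thesis by (simp only: prod_A)
  qed
  also have "even ((?n + 1) * (d + 1))" using m by (cases "even d") simp_all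
  then have "(- 1) ^ ((?n + 1) * (d + 1)) = (1 :: closure)" by (rule neg_one_even_power)
  finally show ?thesis by (simp add: R_def)
qed

text \<open>
The power of \<open>d\<close> that turns the \<open>i\<close>-th iterate of \<open>U\<close>, with \<open>c\<close> replaced by \<open>t/d\<close>, into a polynomial over
\<open>\<int>[t]\<close>. By \<open>sum_denominator_exp\<close> these exponents combine to the \<open>(d+1)^(m-1)\<close> of \<open>derivative_poly_factorization\<close>.
\<close>

fun denominator_exp :: "nat \<Rightarrow> nat \<Rightarrow> nat" where
  "denominator_exp d 0 = 0"
| "denominator_exp d (Suc i) = (d + 1) ^ i"

text \<open>
The \<open>i\<close>-th iterate of \<open>U\<close> at \<open>u = (x + t)/(d+1)\<close>, multiplied by \<open>d\<close> to the power \<open>denominator_exp d i\<close> and by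
\<open>(d+1)^((d+1)^i)\<close>. The variable \<open>x\<close> stands for \<open>\<lambda> = (d+1) u - t\<close>; this choice, instead of \<open>u\<close> itself, makes
the leading coefficient in \<open>t\<close> a unit. The truncated subtractions in the exponents are exact by
\<open>denominator_exp_bounds\<close>.
\<close>

fun scaled_ratio :: "nat \<Rightarrow> nat \<Rightarrow> int poly poly" where
  "scaled_ratio d 0 = [:[:0, 1:]:] + [:0, 1:]"
| "scaled_ratio d (Suc i) =
    of_nat (d ^ (denominator_exp d (Suc i) - (d + 1) * denominator_exp d i)) * scaled_ratio d i ^ (d + 1)
    + [:0, 1:] * (of_nat (d ^ (denominator_exp d (Suc i) - 1) * (d + 1) ^ ((d + 1) ^ Suc i))
      - of_nat (d ^ (denominator_exp d (Suc i) - 1 - d * denominator_exp d i) * (d + 1) ^ ((d + 1) ^ i))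
        * scaled_ratio d i ^ d)"

declare scaled_ratio.simps(2) [simp del]

lemma denominator_exp_bounds:
  "(d + 1) * denominator_exp d i \<le> denominator_exp d (Suc i)"
  "1 + d * denominator_exp d i \<le> denominator_exp d (Suc i)"
proof -
  show "(d + 1) * denominator_exp d i \<le> denominator_exp d (Suc i)"
    by (cases i) simp_all
  show "1 + d * denominator_exp d i \<le> denominator_exp d (Suc i)"
  proof (cases i)
    case (Suc l)
    have "1 \<le> (d + 1) ^ l" by simp
    then show ?thesis unfolding Suc by simp
  qed simp
qed

lemma sum_powers:
  fixes d m :: nat
  shows "1 + d * (\<Sum>i<m. (d + 1) ^ i) = (d + 1) ^ m"
  by (induction m) (simp_all add: algebra_simps)

lemma sum_denominator_exp:
  assumes "m \<ge> 1"
  shows "1 + d * (\<Sum>i<m. denominator_exp d i) = (d + 1) ^ (m - 1)"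
proof -
  obtain l where l: "m = Suc l" using assms by (cases m) auto
  show ?thesis unfolding l by (subst sum.lessThan_Suc_shift) (use sum_powers[of d l] in simp)
qed

lemma eval_scaled_ratio:
  assumes d: "d \<ge> 1" and u: "of_nat (d + 1) * u = x + of_nat d * param"
  shows "eval_param d (scaled_ratio d i) x
    = of_nat d ^ denominator_exp d i * of_nat (d + 1) ^ ((d + 1) ^ i) * ratio_iterate d u i"
proof (induction i)
  case 0
  show ?case unfolding scaled_ratio.simps eval_param_simps using u by simp
next
  case (Suc i)
  define e e' n D B r where "e = denominator_exp d i" and "e' = denominator_exp d (Suc i)"
    and "n = (d + 1) ^ i" and "D = (of_nat d :: closure)" and "B = (of_nat (d + 1) :: closure)"
    and "r = ratio_iterate d u i"
  have IH: "eval_param d (scaled_ratio d i) x = D ^ e * B ^ n * r"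
    using Suc by (simp add: e_def n_def D_def B_def r_def)
  have b1: "e' = (e' - (d + 1) * e) + (d + 1) * e"
    and b2: "e' = (e' - 1 - d * e) + (1 + d * e)" and b3: "e' = (e' - 1) + 1"
    using denominator_exp_bounds[of d i] by (simp_all add: e_def e'_def)
  have n1: "(d + 1) ^ Suc i = n * (d + 1)" and n2: "(d + 1) ^ Suc i = n + n * d"
    by (simp_all add: n_def)
  have pw: "(D ^ e) ^ k = D ^ (k * e)" for k by (metis power_mult mult.commute)
  have D1: "D ^ (e' - (d + 1) * e) * (D ^ e) ^ (d + 1) = D ^ e'"
    unfolding pw power_add[symmetric] by (rule arg_cong[OF b1[symmetric]])
  have D2: "D * D ^ (e' - 1) = D ^ e'"
    unfolding power_Suc[symmetric] by (rule arg_cong[where f = "power D"]) (use b3 in simp)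
  have D3: "D * (D ^ (e' - 1 - d * e) * (D ^ e) ^ d) = D ^ e'"
    unfolding pw power_add[symmetric] power_Suc[symmetric]
    by (rule arg_cong[where f = "power D"]) (use b2 in simp)
  have B1: "(B ^ n) ^ (d + 1) = B ^ ((d + 1) ^ Suc i)" by (simp only: n1 power_mult)
  have B2: "B ^ n * (B ^ n) ^ d = B ^ ((d + 1) ^ Suc i)" by (simp only: n2 power_mult power_add)
  have "eval_param d (scaled_ratio d (Suc i)) x
      = D ^ (e' - (d + 1) * e) * (D ^ e * B ^ n * r) ^ (d + 1)
        + D * param * (D ^ (e' - 1) * B ^ ((d + 1) ^ Suc i)
          - D ^ (e' - 1 - d * e) * B ^ n * (D ^ e * B ^ n * r) ^ d)"
    unfolding scaled_ratio.simps eval_param_simps IH of_nat_mult of_nat_power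
      D_def[symmetric] B_def[symmetric] e_def[symmetric] e'_def[symmetric] n_def[symmetric] ..
  also have "\<dots> = (D ^ (e' - (d + 1) * e) * (D ^ e) ^ (d + 1)) * (B ^ n) ^ (d + 1) * r ^ (d + 1)
        + param * ((D * D ^ (e' - 1)) * B ^ ((d + 1) ^ Suc i)
          - (D * (D ^ (e' - 1 - d * e) * (D ^ e) ^ d)) * (B ^ n * (B ^ n) ^ d) * r ^ d)"
    by (simp only: power_mult_distrib right_diff_distrib mult_ac)
  also have "\<dots> = D ^ e' * B ^ ((d + 1) ^ Suc i) * (r ^ (d + 1) + param * (1 - r ^ d))"
  proof -
    have "E * q + param * (E - E * s) = E * (q + param * (1 - s))" for E q s
      by (simp add: algebra_simps)
    then show ?thesis unfolding D1 D2 D3 B1 B2 .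
  qed
  finally show ?case
    by (simp only: ratio_iterate.simps D_def B_def e'_def r_def)
qed

text \<open>
In the first step the leading coefficients of both summands contribute, and \<open>d - (d+1) = -1\<close>. From then on the power
\<open>A^(d+1)\<close> has larger degree than the other summand, and its factor \<open>d^0\<close> is 1.
\<close>

lemma scaled_ratio_degree:
  assumes d: "d \<ge> 1"
  shows "degree (scaled_ratio d i) = (d + 1) ^ i \<and>
    (lead_coeff (scaled_ratio d i) = 1 \<or> lead_coeff (scaled_ratio d i) = - 1)"
proof (induction i)
  case 0
  show ?case by simp
next
  case (Suc i)
  define A where "A = scaled_ratio d i"
  define n where "n = (d + 1) ^ i"
  have A: "degree A = n" "lead_coeff A = 1 \<or> lead_coeff A = - 1"
    unfolding A_def n_def using Suc by blast+
  then have A0: "A \<noteq> 0" by auto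
  have n0: "n \<ge> 1" by (simp add: n_def)
  have leadp: "lead_coeff (A ^ k) = 1 \<or> lead_coeff (A ^ k) = - 1" for k
  proof -
    have "lead_coeff (A ^ k) = lead_coeff A ^ k" by (rule lead_coeff_power)
    then show ?thesis using A(2) by (cases "even k") auto
  qed
  have degp: "degree (A ^ k) = k * n" for k using A A0 by (simp add: degree_power_eq)
  obtain a b c :: "int poly" where S: "scaled_ratio d (Suc i)
      = smult a (A ^ (d + 1)) + pCons 0 ([:b:] - smult c (A ^ d))"
    and ac: "i = 0 \<Longrightarrow> a = of_nat d \<and> c = of_nat (d + 1)" "i > 0 \<Longrightarrow> a = 1"
  proof
    show "scaled_ratio d (Suc i)
      = smult (of_nat (d ^ (denominator_exp d (Suc i) - (d + 1) * denominator_exp d i))) (A ^ (d + 1))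
       + pCons 0 ([:of_nat (d ^ (denominator_exp d (Suc i) - 1) * (d + 1) ^ ((d + 1) ^ Suc i)):]
         - smult (of_nat (d ^ (denominator_exp d (Suc i) - 1 - d * denominator_exp d i) * (d + 1) ^ ((d + 1) ^ i))) (A ^ d))"
      unfolding scaled_ratio.simps A_def[symmetric] by (simp add: of_nat_poly del: power_Suc of_nat_mult of_nat_power)
    show "of_nat (d ^ (denominator_exp d (Suc i) - (d + 1) * denominator_exp d i)) = of_nat d \<and>
       of_nat (d ^ (denominator_exp d (Suc i) - 1 - d * denominator_exp d i) * (d + 1) ^ ((d + 1) ^ i)) = of_nat (d + 1)"
      if "i = 0" using that by simp
    show "of_nat (d ^ (denominator_exp d (Suc i) - (d + 1) * denominator_exp d i)) = 1"
      if "i > 0" using that by (cases i) simp_all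
  qed
  have nn: "(d + 1) ^ Suc i = (d + 1) * n" by (simp add: n_def)
  have low: "degree (pCons 0 ([:b:] - smult c (A ^ d))) \<le> 1 + d * n"
  proof -
    have "degree ([:b:] - smult c (A ^ d)) \<le> d * n"
      using degp[of d] by (intro degree_diff_le) (auto intro: order_trans[OF degree_smult_le])
    then show ?thesis using degree_pCons_le[of 0 "[:b:] - smult c (A ^ d)"] by linarith
  qed
  show ?case
  proof (cases "i = 0")
    case False
    then have "(d + 1) ^ 1 \<le> n" unfolding n_def by (intro power_increasing) auto
    then have lt: "degree (pCons 0 ([:b:] - smult c (A ^ d))) < degree (smult a (A ^ (d + 1)))"
      using low degp[of "d + 1"] ac(2) False d by simp
    have "degree (scaled_ratio d (Suc i)) = (d + 1) * n"
      unfolding S by (subst degree_add_eq_left[OF lt]) (use ac(2) False degp[of "d + 1"] in simp)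
    moreover have "lead_coeff (scaled_ratio d (Suc i)) = lead_coeff (smult a (A ^ (d + 1)))"
      unfolding S by (metis lead_coeff_add_le[OF lt] add.commute)
    ultimately show ?thesis using leadp[of "d + 1"] ac(2) False nn by simp
  next
    case True
    have A': "A = [:[:0, 1:], 1:]" and n1: "n = 1" using True by (simp_all add: A_def n_def)
    have mon: "coeff (A ^ k) k = 1" for k
      using lead_coeff_power[of A k] degp[of k] n1 by (simp add: A' degree_power_eq)
    have top: "coeff (scaled_ratio d (Suc i)) (d + 1) = - 1"
      unfolding S using mon[of "d + 1"] mon[of d] ac(1)[OF True] d
      by (simp add: coeff_pCons split: nat.split del: power_Suc)
    have "degree (scaled_ratio d (Suc i)) \<le> d + 1"
      unfolding S using low n1 degp[of "d + 1"]
      by (intro degree_add_le) (auto intro: order_trans[OF degree_smult_le])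
    moreover have "degree (scaled_ratio d (Suc i)) \<ge> d + 1"
      using top by (intro le_degree) auto
    ultimately have "degree (scaled_ratio d (Suc i)) = d + 1" by simp
    then show ?thesis using top nn n1 by simp
  qed
qed

section \<open>The product of x minus the derivative over the points of exact period\<close>

definition unit_lead :: "int poly poly \<Rightarrow> bool" where
  "unit_lead P \<longleftrightarrow> lead_coeff P = 1 \<or> lead_coeff P = - 1"

lemma unit_lead_nonzero: "unit_lead P \<Longrightarrow> P \<noteq> 0"
  by (auto simp: unit_lead_def)

lemma unit_lead_1: "unit_lead 1"
  by (simp add: unit_lead_def)

lemma unit_lead_mult: "unit_lead P \<Longrightarrow> unit_lead Q \<Longrightarrow> unit_lead (P * Q)"
  unfolding unit_lead_def lead_coeff_mult by auto

lemma unit_lead_power: "unit_lead P \<Longrightarrow> unit_lead (P ^ n)"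
  by (induction n) (auto simp: unit_lead_1 intro: unit_lead_mult)

lemma unit_lead_prod: "(\<And>i. i \<in> A \<Longrightarrow> unit_lead (P i)) \<Longrightarrow> unit_lead (\<Prod>i\<in>A. P i)"
  by (induction A rule: infinite_finite_induct) (auto simp: unit_lead_1 intro: unit_lead_mult)

lemma unit_lead_factor: "unit_lead (P * Q) \<Longrightarrow> unit_lead P \<Longrightarrow> unit_lead Q"
  unfolding unit_lead_def lead_coeff_mult by (auto simp: minus_equation_iff)

lemma dvd_of_unit_lead_dvd_multiple:
  assumes "unit_lead B" "D \<noteq> 0" "smult D W = B * q"
  obtains P where "W = B * P"
proof -
  \<comment> \<open>If the unit is -1, the division is carried out with \<open>- B\<close>.\<close>
  define u where "u = lead_coeff B"
  have u: "u * u = 1" using assms(1) by (auto simp: unit_lead_def u_def)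
  have "monic (smult u B)" unfolding lead_coeff_smult using u by (simp only: u_def)
  moreover have "smult D W = smult u B * smult u q" using assms(3) u by simp
  ultimately obtain Q where "W = smult u B * Q" using dvd_of_monic_dvd_multiple assms(2) by metis
  then show ?thesis by (intro that[of "smult u Q"]) simp
qed

text \<open>
The explicit form of the product of \<open>x - \<lambda>(z)\<close> over the fixed points of \<open>f^m\<close>, cleared of denominators. With
\<open>u = (x + t)/(d+1)\<close> as above, the first factor \<open>d x - t\<close> is \<open>d (d+1) (u - c)\<close>.
\<close>

definition derivative_poly :: "nat \<Rightarrow> nat \<Rightarrow> int poly poly" where
  "derivative_poly d m = (of_nat d * [:[:0, 1:]:] - [:0, 1:]) *
    ((\<Prod>i<m. scaled_ratio d i)
      - of_nat (d ^ (\<Sum>i<m. denominator_exp d i) * (d + 1) ^ (\<Sum>i<m. (d + 1) ^ i))) ^ d"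

lemma derivative_poly_degree:
  assumes d: "d \<ge> 1" and m: "m \<ge> 1"
  shows "degree (derivative_poly d m) = (d + 1) ^ m" "unit_lead (derivative_poly d m)"
proof -
  let ?A = "\<Prod>i<m. scaled_ratio d i" and ?n = "\<Sum>i<m. (d + 1) ^ i"
  define k where "k = d ^ (\<Sum>i<m. denominator_exp d i) * (d + 1) ^ ?n"
  let ?B = "?A + of_int (- int k)"
  have ul: "unit_lead (scaled_ratio d i)" for i
    using scaled_ratio_degree[OF d, of i] unfolding unit_lead_def by (rule conjunct2)
  have degA: "degree ?A = ?n"
    using scaled_ratio_degree[OF d] ul unit_lead_nonzero
    by (subst degree_prod_eq_sum_degree) auto
  have "0 < ?n" using m by (cases m) simp_all
  then have lt: "degree (of_int (- int k) :: int poly poly) < degree ?A"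
    by (simp add: degA del: of_int_minus)
  have degB: "degree ?B = ?n" using degree_add_eq_left[OF lt] degA by simp
  have ulB: "unit_lead ?B"
    using lead_coeff_add_le[OF lt] unit_lead_prod[of "{..<m}" "scaled_ratio d"] ul
    by (simp only: unit_lead_def add.commute)
  have C: "of_nat d * [:[:0, 1:]:] - [:0, 1:] = [:[:0, of_nat d:], - 1 :: int poly:]"
    by (simp add: of_nat_poly)
  then have ulC: "unit_lead (of_nat d * [:[:0, 1:]:] - [:0, 1:])"
    and degC: "degree (of_nat d * [:[:0, 1:]:] - [:0, 1 :: int poly:]) = 1"
    by (simp_all add: unit_lead_def)
  have W: "derivative_poly d m = (of_nat d * [:[:0, 1:]:] - [:0, 1:]) * ?B ^ d"
    by (simp add: derivative_poly_def k_def)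
  show "unit_lead (derivative_poly d m)"
    unfolding W using ulB ulC by (intro unit_lead_mult unit_lead_power)
  have "degree (derivative_poly d m) = 1 + d * ?n"
    unfolding W degree_mult_eq[OF unit_lead_nonzero[OF ulC] unit_lead_nonzero[OF unit_lead_power[OF ulB]]]
      degree_power_eq[OF unit_lead_nonzero[OF ulB]] degC degB
    by (simp only: mult.commute)
  then show "degree (derivative_poly d m) = (d + 1) ^ m" by (simp only: sum_powers)
qed

lemma eval_derivative_poly:
  assumes d: "d \<ge> 1" and m: "m \<ge> 1"
  shows "eval_param d (derivative_poly d m) x
    = of_nat d ^ ((d + 1) ^ (m - 1)) * (\<Prod>z\<in>fixed_points d m. x - derivative_at d z)"
proof -
  define D B where "D = (of_nat d :: closure)" and "B = (of_nat (d + 1) :: closure)"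
  define u where "u = (x + D * param) / B"
  have B0: "B \<noteq> 0" unfolding B_def by (simp del: of_nat_Suc of_nat_add)
  then have u: "B * u = x + D * param" by (simp add: u_def)
  define w where "w = u - param"
  have wu: "w + param = u" by (simp add: w_def)
  have "B = D + 1" by (simp add: B_def D_def)
  then have w: "B * w = x - param" using u by (simp add: w_def algebra_simps)
  define R where "R = (\<Prod>i<m. ratio_iterate d u i) - 1"
  let ?e = "\<Sum>i<m. denominator_exp d i" and ?n = "\<Sum>i<m. (d + 1) ^ i"
  have "(\<Prod>z\<in>fixed_points d m. x - derivative_at d z) = (\<Prod>z\<in>fixed_points d m. B * (w - z ^ d))"
    by (intro prod.cong refl) (simp add: right_diff_distrib w, simp add: derivative_at_def B_def)
  also have "\<dots> = B ^ ((d + 1) ^ m) * (w * R ^ d)"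
    using prod_fixed_points_minus_power[OF d m, of w]
    by (simp only: prod.distrib prod_constant card_fixed_points[OF d m] wu R_def)
  finally have V: "(\<Prod>z\<in>fixed_points d m. x - derivative_at d z) = B ^ ((d + 1) ^ m) * (w * R ^ d)" .
  have "eval_param d (derivative_poly d m) x
      = (D * x - D * param) * ((\<Prod>i<m. D ^ denominator_exp d i * B ^ ((d + 1) ^ i) * ratio_iterate d u i)
        - D ^ ?e * B ^ ?n) ^ d"
    unfolding derivative_poly_def eval_param_simps
      eval_scaled_ratio[OF d u[unfolded B_def D_def]] of_nat_mult of_nat_power D_def B_def ..
  also have "(\<Prod>i<m. D ^ denominator_exp d i * B ^ ((d + 1) ^ i) * ratio_iterate d u i)
      = D ^ ?e * B ^ ?n * (R + 1)"
    by (simp add: prod.distrib power_sum R_def)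
  also have "D ^ ?e * B ^ ?n * (R + 1) - D ^ ?e * B ^ ?n = D ^ ?e * B ^ ?n * R"
    by (simp add: algebra_simps)
  also have "D * x - D * param = D * (B * w)" by (simp add: w algebra_simps)
  also have "D * (B * w) * (D ^ ?e * B ^ ?n * R) ^ d
      = (D * (D ^ ?e) ^ d) * ((B * (B ^ ?n) ^ d) * (w * R ^ d))"
    by (simp only: power_mult_distrib mult_ac)
  also have "D * (D ^ ?e) ^ d = D ^ (1 + d * ?e)"
    by (simp only: power_add power_one_right power_mult[symmetric] mult.commute[of ?e d])
  also have "B * (B ^ ?n) ^ d = B ^ (1 + d * ?n)"
    by (simp only: power_add power_one_right power_mult[symmetric] mult.commute[of ?n d])
  finally show ?thesis
    unfolding V sum_powers sum_denominator_exp[OF m] D_def .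
qed

lemma derivative_poly_factorization:
  assumes "d \<ge> 1" "m \<ge> 1"
  shows "map_poly to_closure (subst_t (derivative_poly d m) [:0, of_nat d:])
    = smult (of_nat d ^ ((d + 1) ^ (m - 1))) (\<Prod>z\<in>fixed_points d m. [:- derivative_at d z, 1:])"
  by (rule poly_eq_poly_eq_iff[THEN iffD1], rule ext)
    (use eval_derivative_poly[OF assms] in \<open>simp add: eval_param_def poly_prod\<close>)

lemma exists_preimage_poly:
  assumes "\<And>j. tc.integral (coeff p j)" "\<And>j. coeff p j \<in> quotient_field"
  obtains q where "map_poly to_closure q = p"
proof -
  have "\<exists>a. to_closure a = coeff p j" for j
    using integral_in_quotient_field[OF assms(1)[of j] assms(2)[of j]] by metis
  then obtain a where a: "\<And>j. to_closure (a j) = coeff p j" by metis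
  define q where "q = Poly (map a [0..<Suc (degree p)])"
  have "to_closure (coeff q j) = coeff p j" for j
    using a by (auto simp: q_def nth_default_def coeff_eq_0 simp del: upt_Suc)
  then have "map_poly to_closure q = p" by (simp add: poly_eq_iff)
  then show ?thesis by (rule that)
qed

lemma integral_derivative_at:
  assumes "d \<ge> 1" "m \<ge> 1" "z \<in> fixed_points d m"
  shows "tc.integral (derivative_at d z)"
  unfolding derivative_at_def using assms integral_of_fixed[of d m z] integral_param
  by (intro tc.integral_intros) (auto simp: fixed_points_def)

text \<open>
The explicit formula shows that the coefficients are rational in \<open>c\<close>; they are integral because the derivatives are.
\<close>

lemma derivative_product_descends:
  assumes d: "d \<ge> 1" and m: "m \<ge> 1"
  shows "\<exists>F. map_poly to_closure F = (\<Prod>z\<in>fixed_points d m. [:- derivative_at d z, 1:])"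
proof -
  let ?V = "\<Prod>z\<in>fixed_points d m. [:- derivative_at d z, 1:]"
  let ?D = "of_nat d ^ ((d + 1) ^ (m - 1)) :: closure"
  have "coeff ?V j \<in> quotient_field" for j
  proof -
    have "to_closure (coeff (subst_t (derivative_poly d m) [:0, of_nat d:]) j) = ?D * coeff ?V j"
      unfolding tc.coeff_map_poly_hom[symmetric] derivative_poly_factorization[OF assms] coeff_smult ..
    then have "?D * coeff ?V j \<in> quotient_field" using to_closure_in_quotient_field by metis
    then have "(?D * coeff ?V j) / ?D \<in> quotient_field"
      by (intro qf.divide_closed qf.power_closed qf.of_nat_closed)
    then show ?thesis using d by simp
  qed
  moreover have "tc.integral (coeff ?V j)" for j
    by (intro tc.integral_coeff_linear_product integral_derivative_at[OF assms])
  ultimately show ?thesis using exists_preimage_poly by metis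
qed

text \<open>
Let \<open>B\<close> be the product of the polynomials already found for the proper divisors \<open>k\<close> of \<open>m\<close>, and \<open>W\<close> the one for all
fixed points of \<open>f^m\<close>. A multiple of \<open>W\<close> by a power of \<open>d\<close> is divisible by \<open>B\<close>; as \<open>B\<close> has unit
leading coefficient, \<open>W\<close> itself is, and the quotient inherits the unit leading coefficient. The
exponents of \<open>d\<close> match because they add up to \<open>(d+1)^(m-1)\<close> over the divisors of \<open>m\<close>.
\<close>

lemma exact_derivative_poly_exists:
  assumes d: "d \<ge> 1" and m: "m \<ge> 1"
  shows "\<exists>P. unit_lead P \<and> degree P = card (periodic_points d m) \<and>
    map_poly to_closure (subst_t P [:0, of_nat d:])
      = smult (of_nat d ^ (card (periodic_points d m) div (d + 1)))
          (\<Prod>z\<in>periodic_points d m. [:- derivative_at d z, 1:])"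
  using m
proof (induction m rule: less_induct)
  case (less m)
  note m = less.prems
  define N where "N = (\<lambda>k. card (periodic_points d k))"
  define E where "E = (\<lambda>k. N k div (d + 1))"
  define V where "V = (\<lambda>k. \<Prod>z\<in>periodic_points d k. [:- derivative_at d z, 1:])"
  let ?s = "\<lambda>P. map_poly to_closure (subst_t P [:0, of_nat d:])"
  have s_mult: "?s (P * Q) = ?s P * ?s Q" for P Q
    by (simp add: subst_t_mult tcp.hom_mult)
  have s_prod: "?s (\<Prod>i\<in>A. P i) = (\<Prod>i\<in>A. ?s (P i))" for P and A :: "nat set"
    by (simp add: subst_t_prod tcp.hom_prod)
  let ?K = "{k. k dvd m} - {m}"
  have fin: "finite {k. k dvd m}" using m by simp
  have "\<exists>P. unit_lead P \<and> degree P = N k \<and> ?s P = smult (of_nat d ^ E k) (V k)" if "k \<in> ?K" for k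
    unfolding N_def E_def V_def
    using that m by (intro less.IH) (auto intro: dvd_imp_le le_neq_trans Suc_leI dvd_pos_nat)
  then obtain P where P: "\<And>k. k \<in> ?K \<Longrightarrow> unit_lead (P k)" "\<And>k. k \<in> ?K \<Longrightarrow> degree (P k) = N k"
    "\<And>k. k \<in> ?K \<Longrightarrow> ?s (P k) = smult (of_nat d ^ E k) (V k)"
    by metis
  define B where "B = (\<Prod>k\<in>?K. P k)"
  define W where "W = derivative_poly d m"
  have ulB: "unit_lead B" unfolding B_def by (intro unit_lead_prod P(1))
  have sB: "?s B = (\<Prod>k\<in>?K. smult (of_nat d ^ E k) (V k))"
    unfolding B_def s_prod by (intro prod.cong refl P(3))
  have prod_smult: "(\<Prod>k\<in>A. smult (a k) (V k)) = smult (\<Prod>k\<in>A. a k) (\<Prod>k\<in>A. V k)" for a A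
    by (induction A rule: infinite_finite_induct) (simp_all add: mult_ac)
  have "(\<Prod>k | k dvd m. smult (of_nat d ^ E k) (V k)) = smult (of_nat d ^ ((d + 1) ^ (m - 1))) (\<Prod>k | k dvd m. V k)"
    unfolding prod_smult power_sum[symmetric] E_def N_def sum_card_periodic_points_div[OF d m] ..
  also have "\<dots> = ?s W"
    unfolding W_def derivative_poly_factorization[OF d m] prod_fixed_points[OF d m] V_def ..
  finally have sW: "?s W = ?s B * smult (of_nat d ^ E m) (V m)"
    unfolding sB by (subst (asm) prod.remove[OF fin, of m]) (simp_all only: mult.commute mem_Collect_eq dvd_refl)
  obtain F where F: "map_poly to_closure F = V m"
    using exact_factor_exists[OF d derivative_product_descends[OF d] m] unfolding V_def by blast
  obtain n A where A: "subst_t A [:0, of_nat d:] = smult (of_nat d ^ n) F"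
    by (rule scaled_in_range_subst_t)
  have sA: "?s A = smult (of_nat d ^ n) (V m)"
    unfolding A by (simp add: tc.map_poly_hom_smult F tc.hom_power tc.hom_of_nat)
  have s_of_nat: "?s (of_nat k) = [:of_nat k:]" for k
    unfolding subst_t_of_nat tcp.hom_of_nat by (rule of_nat_poly)
  have "?s (of_nat (d ^ n) * W) = ?s (B * (A * of_nat (d ^ E m)))"
    unfolding s_mult s_of_nat sW sA by (simp add: mult_ac)
  then have "of_nat (d ^ n) * W = B * (A * of_nat (d ^ E m))"
    using subst_t_inject[of "[:0, of_nat d:]"] d by simp
  then have "smult (of_nat (d ^ n)) W = B * (A * of_nat (d ^ E m))"
    by (simp add: of_nat_poly)
  moreover have "of_nat (d ^ n) \<noteq> (0 :: int poly)" using d by simp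
  ultimately obtain Q where Q: "W = B * Q"
    using dvd_of_unit_lead_dvd_multiple[OF ulB] by metis
  have "?s B * ?s Q = ?s B * smult (of_nat d ^ E m) (V m)"
    using sW unfolding Q s_mult .
  moreover have "?s B \<noteq> 0"
    using unit_lead_nonzero[OF ulB] subst_t_inject[of "[:0, of_nat d:]" B 0] d
    by (auto simp: subst_t_0)
  ultimately have sQ: "?s Q = smult (of_nat d ^ E m) (V m)"
    by (simp only: mult_cancel_left) simp
  have ulQ: "unit_lead Q"
    using unit_lead_factor[OF _ ulB] derivative_poly_degree(2)[OF d m] Q by (simp add: W_def)
  have degB: "degree B = (\<Sum>k\<in>?K. N k)"
    unfolding B_def using P(1,2) unit_lead_nonzero
    by (subst degree_prod_eq_sum_degree) auto
  have "degree W = degree B + degree Q"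
    unfolding Q using ulB ulQ unit_lead_nonzero by (intro degree_mult_eq) auto
  moreover have "degree W = N m + (\<Sum>k\<in>?K. N k)"
    unfolding W_def derivative_poly_degree(1)[OF d m] card_fixed_points_eq_sum[OF d m] N_def
    by (rule sum.remove[OF fin]) simp
  ultimately have "degree Q = N m" using degB by simp
  with ulQ sQ show ?case unfolding N_def E_def V_def by blast
qed

section \<open>Integrality over d c and over the inverse of c\<close>

lemma param_neq_0: "param \<noteq> 0"
  by (simp add: param_def)

lemma pcompose_inject:
  fixes p q r :: "int poly"
  assumes "degree r > 0" "pcompose p r = pcompose q r"
  shows "p = q"
  using pcompose_eq_0[OF _ assms(1), of "p - q"] assms(2) by (simp add: pcompose_diff)

definition scaled_hom :: "nat \<Rightarrow> int poly \<Rightarrow> closure" where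
  "scaled_hom d p = to_closure (pcompose p [:0, of_nat d:])"

lemma integral_closure_scaled_hom:
  assumes "d \<ge> 1"
  shows "integral_closure (scaled_hom d)"
proof
  fix p q
  show "scaled_hom d (p + q) = scaled_hom d p + scaled_hom d q"
    by (simp add: scaled_hom_def pcompose_add tc.hom_add)
  show "scaled_hom d (p * q) = scaled_hom d p * scaled_hom d q"
    by (simp add: scaled_hom_def pcompose_mult tc.hom_mult)
  show "scaled_hom d p = 0 \<Longrightarrow> p = 0"
    using assms pcompose_eq_0[of p "[:0, of_nat d:]"] by (simp add: scaled_hom_def)
qed (simp_all add: scaled_hom_def pcompose_1)

text \<open>
The ring \<open>\<int>[d c]\<close> is integrally closed, and a power of \<open>d\<close> carries every element of \<open>\<int>[c]\<close> into it.
\<close>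

lemma integral_over_scaled_param:
  assumes d: "d \<ge> 1"
    and x: "integral_closure.integral (scaled_hom d) (to_closure (smult (of_nat d ^ E) a))"
  obtains g where "pcompose g [:0, of_nat d:] = smult (of_nat d ^ E) a"
proof -
  obtain g where g: "pcompose g [:0, of_nat d:] = smult (of_nat d ^ degree a) a"
    using scaled_in_range_pcompose[of a "degree a"] by blast
  have "to_closure (smult (of_nat d ^ E) a) * scaled_hom d [:of_nat d ^ degree a:]
      = scaled_hom d (smult (of_nat d ^ E) g)"
    by (simp add: scaled_hom_def pcompose_smult g tc.hom_mult[symmetric] mult.commute)
  moreover have "[:of_nat d ^ degree a:] \<noteq> (0 :: int poly)" using d by simp
  ultimately have "to_closure (smult (of_nat d ^ E) a) \<in> range (scaled_hom d)"
    using integrally_closed[OF integral_closure_scaled_hom[OF d] x] by blast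
  then show ?thesis using that by (auto simp: scaled_hom_def)
qed

definition reversal :: "nat \<Rightarrow> int poly \<Rightarrow> int poly" where
  "reversal n p = (\<Sum>i\<le>n. monom (coeff p (n - i)) i)"

lemma coeff_reversal: "coeff (reversal n p) i = (if i \<le> n then coeff p (n - i) else 0)"
  by (simp add: reversal_def coeff_sum)

lemma degree_reversal: "degree (reversal n p) \<le> n"
  by (intro degree_le) (simp add: coeff_reversal)

lemma poly_eq_sum:
  fixes p :: "'a::comm_semiring_1 poly"
  assumes "degree p \<le> n"
  shows "poly p x = (\<Sum>i\<le>n. coeff p i * x ^ i)"
  unfolding poly_altdef using assms by (intro sum.mono_neutral_left) (auto simp: coeff_eq_0)

lemma poly_reversal:
  fixes x :: "'a::field_char_0"
  assumes "x \<noteq> 0" "degree p \<le> n"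
  shows "poly (map_poly of_int (reversal n p)) x = x ^ n * poly (map_poly of_int p) (inverse x)"
proof -
  have "poly (map_poly of_int (reversal n p)) x = (\<Sum>i\<le>n. of_int (coeff p (n - i)) * x ^ i)"
    using degree_reversal[of n p] by (subst poly_eq_sum[of _ n]) (auto simp: coeff_reversal)
  also have "\<dots> = (\<Sum>i\<le>n. of_int (coeff p i) * x ^ (n - i))"
    by (rule sum.reindex_bij_witness[of _ "\<lambda>i. n - i" "\<lambda>i. n - i"]) auto
  also have "\<dots> = (\<Sum>i\<le>n. x ^ n * (of_int (coeff p i) * inverse x ^ i))"
    using assms(1) by (intro sum.cong refl) (simp add: power_diff field_simps)
  also have "\<dots> = x ^ n * poly (map_poly of_int p) (inverse x)"
    using assms(2) by (subst poly_eq_sum[of _ n]) (auto simp: sum_distrib_left)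
  finally show ?thesis .
qed

lemma to_closure_eq_poly: "to_closure p = poly (map_poly of_int p) param"
proof (induction p)
  case (pCons a p)
  have "pCons a p = [:a:] + [:0, 1:] * p" by simp
  then have "to_closure (pCons a p) = to_closure [:a:] + param * to_closure p"
    by (metis tc.hom_add tc.hom_mult param_def)
  moreover have "to_closure [:a:] = of_int a"
    by (metis of_int_poly tc.hom_of_int of_int_eq_id id_apply)
  ultimately show ?case using pCons by (simp add: map_poly_pCons)
qed simp

definition inverse_hom :: "int poly \<Rightarrow> closure" where
  "inverse_hom p = poly (map_poly of_int p) (inverse param)"

lemma to_closure_reversal: "degree p \<le> n \<Longrightarrow> to_closure (reversal n p) = param ^ n * inverse_hom p"
  using poly_reversal[OF param_neq_0] by (simp add: to_closure_eq_poly inverse_hom_def)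

lemma inverse_hom_reversal: "degree p \<le> n \<Longrightarrow> inverse_hom (reversal n p) = inverse param ^ n * to_closure p"
  using poly_reversal[of "inverse param" p n] param_neq_0 by (simp add: to_closure_eq_poly inverse_hom_def)

interpretation inv: integral_closure inverse_hom
proof
  fix p q
  show "inverse_hom (p + q) = inverse_hom p + inverse_hom q"
    by (simp add: inverse_hom_def of_int_poly_hom.hom_add)
  show "inverse_hom (p * q) = inverse_hom p * inverse_hom q"
    by (simp add: inverse_hom_def of_int_poly_hom.hom_mult)
  assume "inverse_hom p = 0"
  then have "to_closure (reversal (degree p) p) = 0" by (simp add: to_closure_reversal)
  then have "coeff (reversal (degree p) p) 0 = 0" by simp
  then show "p = 0" by (simp add: coeff_reversal)
qed (simp_all add: inverse_hom_def)

interpretation invp: map_poly_inj_comm_ring_hom inverse_hom ..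

lemma inverse_hom_monom: "inverse_hom (monom 1 k) = inverse param ^ k"
  by (simp add: inverse_hom_def poly_monom map_poly_monom)

text \<open>
Integrality over \<open>\<int>[1/c]\<close> is a bound for the degree: an integral \<open>a/c^k\<close> is a polynomial in \<open>1/c\<close>.
\<close>

lemma degree_le_of_integral:
  assumes "inv.integral (to_closure a * inverse param ^ k)"
  shows "degree a \<le> k"
proof (cases "a = 0")
  case False
  have "to_closure a * inverse param ^ k * inverse_hom (monom 1 (degree a))
      = inverse_hom (reversal (degree a) a * monom 1 k)"
    by (simp add: inverse_hom_reversal inverse_hom_monom inv.hom_mult)
  then obtain g where g: "to_closure a * inverse param ^ k = inverse_hom g"
    using integrally_closed[OF inv.integral_closure_axioms assms]
    by (metis monom_eq_0_iff one_neq_zero rangeE)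
  define n where "n = degree g"
  have "to_closure (monom 1 k) = param ^ k" for k
    by (simp add: to_closure_eq_poly poly_monom map_poly_monom)
  then have "to_closure (a * monom 1 n) = to_closure (monom 1 k * reversal n g)"
    using param_neq_0 g[symmetric]
    by (simp add: tc.hom_mult to_closure_reversal n_def power_inverse)
  then have "a * monom 1 n = monom 1 k * reversal n g" by simp
  then have "degree a + n = degree (monom 1 k * reversal n g)"
    using False by (metis degree_mult_eq degree_monom_eq monom_eq_0_iff one_neq_zero)
  also have "\<dots> \<le> k + n"
    using degree_mult_le[of "monom 1 k" "reversal n g"] degree_reversal[of n g]
    by (simp add: degree_monom_eq)
  finally show ?thesis by simp
qed simp

text \<open>
Let \<open>r\<^sub>i = y\<^sub>i^d / c\<close> along the orbit \<open>y\<^sub>i\<close> of \<open>z\<close>, and \<open>s = 1/c\<close>. Then \<open>s^d r\<^sub>j = r\<^sub>i (r\<^sub>i + 1)^d\<close> for \<open>j = i + 1\<close>, so by induction a power of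
\<open>s\<close> times \<open>r\<^sub>i\<close> is a monic polynomial in \<open>r\<^sub>0\<close> over \<open>\<int>[s]\<close>, of degree \<open>(d+1)^i\<close>. For \<open>i = m\<close> the orbit closes up
and this becomes a monic equation for \<open>r\<^sub>0\<close>; finally \<open>\<lambda>(z)/c = (d+1) r\<^sub>0 + 1\<close>.
\<close>

lemma inverse_integral_derivative:
  assumes d: "d \<ge> 1" and m: "m \<ge> 1" and z: "z \<in> fixed_points d m"
  shows "inv.integral (derivative_at d z * inverse param)"
proof -
  define r where "r = (\<lambda>i. ((dyn_map d ^^ i) z) ^ d * inverse param)"
  have r_Suc: "inverse param ^ d * r (Suc i) = r i * (r i + 1) ^ d" for i
  proof -
    define y where "y = (dyn_map d ^^ i) z"
    have "dyn_map d y = y * (param * (r i + 1))"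
      using param_neq_0 by (simp add: dyn_map_def r_def y_def[symmetric] field_simps)
    then have "r (Suc i) = y ^ d * (param ^ d * (r i + 1) ^ d) * inverse param"
      by (simp add: r_def y_def[symmetric] power_mult_distrib)
    then show ?thesis
      using param_neq_0 by (simp add: r_def y_def[symmetric] power_inverse)
  qed
  have "\<exists>T e. monic T \<and> degree T = (d + 1) ^ i \<and>
      poly (map_poly inverse_hom T) (r 0) = inverse param ^ e * r i" for i
  proof (induction i)
    case 0
    show ?case by (intro exI[of _ "[:0, 1:]"] exI[of _ 0]) (simp add: inv.map_poly_pCons_hom)
  next
    case (Suc i)
    then obtain T e where T: "monic T" "degree T = (d + 1) ^ i"
      "poly (map_poly inverse_hom T) (r 0) = inverse param ^ e * r i" by blast
    define S where "S = T + [:monom 1 e:]"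
    have lt: "degree [:monom 1 e:] < degree T" using T(2) by simp
    have S: "degree S = degree T" "monic S"
      using degree_add_eq_left[OF lt] lead_coeff_add_le[OF lt] T(1)
      by (simp_all add: S_def add.commute)
    have T0: "T \<noteq> 0" and S0: "S \<noteq> 0" using T(1) S(2) by auto
    have "monic (T * S ^ d)" using T(1) S(2) by (simp only: lead_coeff_mult lead_coeff_power) simp
    moreover have "degree (T * S ^ d) = (d + 1) ^ Suc i"
      using T0 S0 S(1) T(2) by (simp add: degree_mult_eq degree_power_eq)
    moreover have "poly (map_poly inverse_hom (T * S ^ d)) (r 0) = inverse param ^ ((d + 1) * e + d) * r (Suc i)"
    proof -
      have "poly (map_poly inverse_hom S) (r 0) = inverse param ^ e * (r i + 1)"
        by (simp add: S_def invp.hom_add T(3) inv.map_poly_pCons_hom inverse_hom_monom algebra_simps)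
      then have "poly (map_poly inverse_hom (T * S ^ d)) (r 0)
          = inverse param ^ e * r i * (inverse param ^ e * (r i + 1)) ^ d"
        by (simp add: invp.hom_mult invp.hom_power T(3))
      also have "\<dots> = inverse param ^ e * (inverse param ^ e) ^ d * (r i * (r i + 1) ^ d)"
        by (simp add: power_mult_distrib)
      also have "\<dots> = inverse param ^ ((d + 1) * e + d) * r (Suc i)"
        unfolding r_Suc[symmetric] by (simp add: power_add power_mult[symmetric] mult.commute)
      finally show ?thesis .
    qed
    ultimately show ?case by blast
  qed
  then obtain T e where T: "monic T" "degree T = (d + 1) ^ m"
    "poly (map_poly inverse_hom T) (r 0) = inverse param ^ e * r m" by blast
  have "r m = r 0" using z by (simp add: r_def fixed_points_def)
  define S where "S = T + [:0, - monom 1 e:]"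
  have "(d + 1) ^ 1 \<le> (d + 1) ^ m" using m by (intro power_increasing) auto
  then have lt: "degree [:0, - monom 1 e :: int poly:] < degree T" using T(2) d by simp
  have "monic S"
    unfolding S_def using lead_coeff_add_le[OF lt] T(1) by (simp only: add.commute)
  moreover have "poly (map_poly inverse_hom S) (r 0) = 0"
    using T(3) \<open>r m = r 0\<close>
    by (simp add: S_def invp.hom_add inv.map_poly_pCons_hom inv.hom_uminus inverse_hom_monom mult.commute)
  ultimately have "inv.integral (r 0)" unfolding inv.integral_def by blast
  then have "inv.integral (of_nat (d + 1) * r 0 + 1)"
    by (intro inv.integral_intros)
  also have "of_nat (d + 1) * r 0 + 1 = derivative_at d z * inverse param"
    using param_neq_0 by (simp add: r_def derivative_at_def distrib_right)
  finally show ?thesis .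
qed

section \<open>The multiplier polynomial\<close>

definition cycle_set :: "nat \<Rightarrow> nat \<Rightarrow> closure set set" where
  "cycle_set d m = orbit_of (dyn_map d) m ` periodic_points d m"

definition cycle_multiplier :: "nat \<Rightarrow> closure set \<Rightarrow> closure" where
  "cycle_multiplier d C = (\<Prod>z\<in>C. derivative_at d z)"

definition cycle_poly :: "nat \<Rightarrow> nat \<Rightarrow> closure poly" where
  "cycle_poly d m = (\<Prod>C\<in>cycle_set d m. [:- cycle_multiplier d C, 1:])"

lemma cycle_set_partition:
  assumes m: "m \<ge> 1"
  shows "\<Union>(cycle_set d m) = periodic_points d m"
    and "\<And>C. C \<in> cycle_set d m \<Longrightarrow> finite C \<and> card C = m"
    and "\<And>C C'. C \<in> cycle_set d m \<Longrightarrow> C' \<in> cycle_set d m \<Longrightarrow> C \<noteq> C' \<Longrightarrow> C \<inter> C' = {}"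
proof -
  show "\<Union>(cycle_set d m) = periodic_points d m"
    unfolding cycle_set_def using orbit_of_properties(3,4)[OF m, of _ "dyn_map d"] by blast
  show "finite C \<and> card C = m" if "C \<in> cycle_set d m" for C
    using that orbit_of_properties(1,2)[OF m, of _ "dyn_map d"] unfolding cycle_set_def by auto
  show "C \<inter> C' = {}" if C: "C \<in> cycle_set d m" "C' \<in> cycle_set d m" "C \<noteq> C'" for C C'
  proof -
    obtain z w where "z \<in> periodic_points d m" "C = orbit_of (dyn_map d) m z"
      "w \<in> periodic_points d m" "C' = orbit_of (dyn_map d) m w"
      using C(1,2) unfolding cycle_set_def by auto
    then show ?thesis using orbits_disjoint[OF m] C(3) by simp
  qed
qed

lemma finite_cycle_set:
  assumes "d \<ge> 1" "m \<ge> 1"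
  shows "finite (cycle_set d m)"
  using finite_periodic_points[OF assms] by (simp add: cycle_set_def)

lemma prod_cycles:
  fixes h :: "closure \<Rightarrow> 'a::comm_monoid_mult"
  assumes m: "m \<ge> 1" and S: "S \<subseteq> cycle_set d m"
  shows "(\<Prod>z\<in>\<Union>S. h z) = (\<Prod>C\<in>S. \<Prod>z\<in>C. h z)"
proof -
  have "prod h (\<Union>S) = (prod \<circ> prod) h S"
  proof (rule prod.Union_disjoint)
    show "\<forall>A\<in>S. finite A"
      using S cycle_set_partition(2)[OF m, of _ d] by auto
    show "\<forall>A\<in>S. \<forall>B\<in>S. A \<noteq> B \<longrightarrow> A \<inter> B = {}"
      using S cycle_set_partition(3)[OF m, of _ d] by (meson subsetD)
  qed
  then show ?thesis by (simp add: comp_def)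
qed

lemma sum_cycles:
  fixes h :: "closure \<Rightarrow> 'a::comm_monoid_add"
  assumes m: "m \<ge> 1"
  shows "(\<Sum>z\<in>periodic_points d m. h z) = (\<Sum>C\<in>cycle_set d m. \<Sum>z\<in>C. h z)"
proof -
  have "sum h (\<Union>(cycle_set d m)) = (sum \<circ> sum) h (cycle_set d m)"
  proof (rule sum.Union_disjoint)
    show "\<forall>A\<in>cycle_set d m. finite A"
      using cycle_set_partition(2)[OF m, of _ d] by auto
    show "\<forall>A\<in>cycle_set d m. \<forall>B\<in>cycle_set d m. A \<noteq> B \<longrightarrow> A \<inter> B = {}"
      using cycle_set_partition(3)[OF m, of _ d] by (meson subsetD)
  qed
  then show ?thesis by (simp add: comp_def cycle_set_partition(1)[OF m])
qed

lemma card_periodic_points_eq: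
  assumes "m \<ge> 1"
  shows "card (periodic_points d m) = m * card (cycle_set d m)"
proof -
  have "card (periodic_points d m) = (\<Sum>C\<in>cycle_set d m. card C)"
    using sum_cycles[OF assms, of "\<lambda>_. 1::nat" d] by simp
  also have "\<dots> = (\<Sum>C\<in>cycle_set d m. m)"
    using cycle_set_partition(2)[OF assms] by (intro sum.cong) auto
  finally show ?thesis by simp
qed

lemma multiplier_eq_cycle_multiplier:
  assumes m: "m \<ge> 1" and C: "C \<in> cycle_set d m" "z \<in> C"
  shows "multiplier d m z = cycle_multiplier d C"
proof -
  obtain w where w: "w \<in> periodic_points d m" "C = orbit_of (dyn_map d) m w"
    using C(1) by (auto simp: cycle_set_def)
  then have z: "z \<in> periodic_points d m" using orbit_of_properties(4)[OF m w(1)] C(2) by auto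
  have "C = orbit_of (dyn_map d) m z" using orbit_of_eq[OF m w(1)] C(2) w(2) by simp
  then show ?thesis
    unfolding multiplier_eq_prod cycle_multiplier_def orbit_of_def
    by (simp add: prod.reindex[OF inj_on_orbit[OF m z]])
qed

lemma periodic_subset_fixed: "periodic_points d m \<subseteq> fixed_points d m"
  by (auto simp: exact_period_def fixed_points_def)

lemma cycle_poly_power:
  assumes m: "m \<ge> 1"
  shows "(\<Prod>z\<in>periodic_points d m. [:- multiplier d m z, 1:]) = cycle_poly d m ^ m"
proof -
  have "(\<Prod>z\<in>periodic_points d m. [:- multiplier d m z, 1:])
      = (\<Prod>C\<in>cycle_set d m. \<Prod>z\<in>C. [:- multiplier d m z, 1:])"
    using prod_cycles[OF m order_refl, of _ d] by (simp only: cycle_set_partition(1)[OF m])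
  also have "\<dots> = (\<Prod>C\<in>cycle_set d m. \<Prod>z\<in>C. [:- cycle_multiplier d C, 1:])"
    using multiplier_eq_cycle_multiplier[OF m] by (intro prod.cong refl) simp
  also have "\<dots> = (\<Prod>C\<in>cycle_set d m. [:- cycle_multiplier d C, 1:] ^ m)"
    using cycle_set_partition(2)[OF m] by (intro prod.cong refl) (simp add: prod_constant del: power_Suc)
  finally show ?thesis by (simp add: cycle_poly_def prod_power_distrib)
qed

text \<open>
Summed over the points of exact period \<open>m\<close>, the powers of the multiplier are rational, being values of a
polynomial at all roots of the dynatomic polynomial. Each cycle is counted \<open>m\<close> times in this sum, so the
power sums over the cycles are rational as well.
\<close>

lemma cycle_poly_descends:
  assumes d: "d \<ge> 1" and m: "m \<ge> 1"
  shows "\<exists>q. map_poly to_closure q = cycle_poly d m"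
proof -
  have fin: "finite (periodic_points d m)" by (rule finite_periodic_points[OF assms])
  have "(\<Sum>C\<in>cycle_set d m. cycle_multiplier d C ^ k) \<in> quotient_field" for k
  proof -
    define g where "g = map_poly to_closure (pderiv (f_iter d m) ^ k)"
    have g: "poly g z = multiplier d m z ^ k" for z
      by (simp add: g_def tcp.hom_power multiplier_def)
    have "(\<Sum>z\<in>periodic_points d m. poly g z) \<in> quotient_field"
    proof (rule qf.sum_poly_over_roots_closed[OF fin])
      show "coeff (\<Prod>z\<in>periodic_points d m. [:- z, 1:]) j \<in> quotient_field" for j
        unfolding dynatomic_factorization[OF assms, symmetric] tc.coeff_map_poly_hom
        by (rule to_closure_in_quotient_field)
      show "coeff g j \<in> quotient_field" for j
        unfolding g_def tc.coeff_map_poly_hom by (rule to_closure_in_quotient_field)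
    qed
    also have "(\<Sum>z\<in>periodic_points d m. poly g z) = (\<Sum>C\<in>cycle_set d m. \<Sum>z\<in>C. cycle_multiplier d C ^ k)"
      unfolding sum_cycles[OF m] g using multiplier_eq_cycle_multiplier[OF m]
      by (intro sum.cong refl) simp
    also have "\<dots> = (\<Sum>C\<in>cycle_set d m. of_nat m * cycle_multiplier d C ^ k)"
      using cycle_set_partition(2)[OF m] by (intro sum.cong refl) simp
    also have "\<dots> = of_nat m * (\<Sum>C\<in>cycle_set d m. cycle_multiplier d C ^ k)"
      by (simp add: sum_distrib_left)
    finally have "of_nat m * (\<Sum>C\<in>cycle_set d m. cycle_multiplier d C ^ k) / of_nat m \<in> quotient_field"
      by (intro qf.divide_closed qf.of_nat_closed)
    then show ?thesis using m by simp
  qed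
  then have "coeff (cycle_poly d m) j \<in> quotient_field" for j
    unfolding cycle_poly_def by (rule qf.coeffs_closed[OF finite_cycle_set[OF assms] refl])
  moreover have "tc.integral (coeff (cycle_poly d m) j)" for j
    unfolding cycle_poly_def cycle_multiplier_def
    using cycle_set_partition(1)[OF m] periodic_subset_fixed
    by (intro tc.integral_coeff_linear_product tc.integral_prod integral_derivative_at[OF assms]) blast
  ultimately show ?thesis using exists_preimage_poly by metis
qed

lemma multiplier_poly_factorization:
  assumes d: "d \<ge> 1" and m: "m \<ge> 1"
  shows "map_poly to_closure (multiplier_poly d m) = cycle_poly d m"
proof -
  obtain q where q: "map_poly to_closure q = cycle_poly d m"
    using cycle_poly_descends[OF assms] by blast
  have monic: "monic q" by (rule monic_of_map_poly_prod[OF q[unfolded cycle_poly_def]])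
  have rhs: "(\<Prod>\<alpha>\<in>#proots (map_poly to_closure (dynatomic d m)). [:- multiplier d m \<alpha>, 1:])
      = map_poly to_closure q ^ m"
    unfolding proots_dynatomic[OF assms] q cycle_poly_power[OF m, symmetric]
    by (simp add: prod_unfold_prod_mset)
  have "multiplier_poly d m = q"
    unfolding multiplier_poly_def rhs
  proof (rule the_equality)
    fix p assume p: "monic p \<and> map_poly to_closure p ^ m = map_poly to_closure q ^ m"
    then have "map_poly to_closure (p ^ m) = map_poly to_closure (q ^ m)"
      by (simp only: tcp.hom_power)
    then have "p ^ m = q ^ m" by simp
    then show "p = q" using p monic monic_power_inject m by blast
  qed (use monic in simp)
  then show ?thesis using q by simp
qed

text \<open>
The polynomial of \<open>exact_derivative_poly_exists\<close> has its coefficients in \<open>\<int>[d c]\<close>, and \<open>d^E\<close> is its leading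
coefficient in \<open>x\<close>. Kronecker's lemma applies to each union of cycles.
\<close>

lemma scaled_coeff_integral:
  assumes d: "d \<ge> 1" and m: "m \<ge> 1"
  defines "E \<equiv> card (periodic_points d m) div (d + 1)"
  shows "integral_closure.integral (scaled_hom d) (of_nat d ^ E * coeff (cycle_poly d m) j)"
proof -
  interpret t: integral_closure "scaled_hom d" by (rule integral_closure_scaled_hom[OF d])
  obtain P where P: "map_poly to_closure (subst_t P [:0, of_nat d:])
      = smult (of_nat d ^ E) (\<Prod>z\<in>periodic_points d m. [:- derivative_at d z, 1:])"
    using exact_derivative_poly_exists[OF d m] unfolding E_def by blast
  have int: "t.integral (coeff (smult (of_nat d ^ E) (\<Prod>z\<in>periodic_points d m. [:- derivative_at d z, 1:])) j)" for j
    unfolding P[symmetric] tc.coeff_map_poly_hom coeff_subst_t scaled_hom_def[symmetric]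
    by (rule t.integral_hom)
  have "t.integral (of_nat d ^ E * (\<Prod>C\<in>S. - cycle_multiplier d C))" if "S \<subseteq> cycle_set d m" for S
  proof -
    have "\<Union>S \<subseteq> periodic_points d m" using that cycle_set_partition(1)[OF m] by blast
    then have "t.integral (of_nat d ^ E * (\<Prod>z\<in>\<Union>S. derivative_at d z))"
      by (rule t.integral_subset_product[OF finite_periodic_points[OF d m] _ int])
    then have "t.integral ((- 1) ^ card S * (of_nat d ^ E * (\<Prod>C\<in>S. cycle_multiplier d C)))"
      unfolding prod_cycles[OF m that] cycle_multiplier_def
      by (rule t.integral_mult[OF t.integral_power[OF t.integral_uminus[OF t.integral_1]]])
    then show ?thesis by (simp add: prod_uminus mult_ac)
  qed
  then show ?thesis
    unfolding cycle_poly_def coeff_linear_product[OF finite_cycle_set[OF d m]] sum_distrib_left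
    by (intro t.integral_sum) auto
qed

lemma degree_multiplier_poly_coeff:
  assumes d: "d \<ge> 1" and m: "m \<ge> 1"
  shows "degree (coeff (multiplier_poly d m) j) \<le> m * (card (cycle_set d m) - j)"
proof (rule degree_le_of_integral)
  let ?C = "cycle_set d m"
  have fin: "finite ?C" by (rule finite_cycle_set[OF assms])
  have "inv.integral ((\<Prod>C\<in>S. - cycle_multiplier d C) * inverse param ^ (m * (card ?C - j)))"
    if S: "S \<subseteq> ?C" "card (?C - S) = j" for S
  proof -
    have "card ?C - j = card S"
      using S fin card_mono[OF fin S(1)] by (auto simp: card_Diff_subset finite_subset)
    then have "inverse param ^ (m * (card ?C - j)) = (\<Prod>C\<in>S. inverse param ^ m)"
      by (simp add: power_mult)
    also have "\<dots> = (\<Prod>C\<in>S. \<Prod>z\<in>C. inverse param)"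
      using S(1) cycle_set_partition(2)[OF m] by (intro prod.cong refl) (auto simp: subset_iff)
    finally have "(\<Prod>C\<in>S. - cycle_multiplier d C) * inverse param ^ (m * (card ?C - j))
        = (\<Prod>C\<in>S. - (\<Prod>z\<in>C. derivative_at d z * inverse param))"
      by (simp only: prod.distrib[symmetric]) (simp add: cycle_multiplier_def prod.distrib)
    moreover have "inv.integral (\<Prod>C\<in>S. - (\<Prod>z\<in>C. derivative_at d z * inverse param))"
      using S(1) cycle_set_partition(1)[OF m] periodic_subset_fixed
      by (intro inv.integral_prod inv.integral_uminus inverse_integral_derivative[OF assms]) blast
    ultimately show ?thesis by simp
  qed
  then show "inv.integral (to_closure (coeff (multiplier_poly d m) j) * inverse param ^ (m * (card ?C - j)))"
    unfolding tc.coeff_map_poly_hom[symmetric] multiplier_poly_factorization[OF assms] cycle_poly_def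
      coeff_linear_product[OF fin] sum_distrib_right
    by (intro inv.integral_sum) auto
qed

lemma to_closure_smult: "to_closure (smult (of_nat d ^ k) a) = of_nat d ^ k * to_closure a"
proof -
  have "smult (of_nat d ^ k) a = of_nat d ^ k * a" by (simp add: of_nat_poly poly_const_pow)
  then show ?thesis by (simp only: tc.hom_mult tc.hom_power tc.hom_of_nat)
qed

text \<open>
Both \<open>g\<close> and the constant column of the polynomial of \<open>exact_derivative_poly_exists\<close> are, up to sign, \<open>d^E\<close> times
the product of the derivatives over all points of exact period \<open>m\<close>. Only the signs of the two products of
negatives differ, one having as many factors as there are points, the other as there are cycles.
\<close>

lemma constant_column:
  assumes d: "d \<ge> 1" and m: "m \<ge> 1"
    and g: "pcompose g [:0, of_nat d:]
      = smult (of_nat d ^ (card (periodic_points d m) div (d + 1))) (coeff (multiplier_poly d m) 0)"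
  shows "coeff g (card (periodic_points d m)) = 1 \<or> coeff g (card (periodic_points d m)) = - 1"
proof -
  define N E where "N = card (periodic_points d m)" and "E = N div (d + 1)"
  obtain P where P: "unit_lead P" "degree P = N" "map_poly to_closure (subst_t P [:0, of_nat d:])
      = smult (of_nat d ^ E) (\<Prod>z\<in>periodic_points d m. [:- derivative_at d z, 1:])"
    using exact_derivative_poly_exists[OF d m] unfolding E_def N_def by blast
  let ?L = "\<Prod>z\<in>periodic_points d m. derivative_at d z"
  define s t where "s = (- 1 :: int) ^ N" and "t = (- 1 :: int) ^ card (cycle_set d m)"
  have st: "s = 1 \<or> s = - 1" "t = 1 \<or> t = - 1"
    unfolding s_def t_def by (metis neg_one_even_power neg_one_odd_power)+
  have "to_closure (pcompose (column P 0) [:0, of_nat d:])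
      = coeff (map_poly to_closure (subst_t P [:0, of_nat d:])) 0"
    by (simp add: coeff_subst_t)
  also have "\<dots> = of_int s * (of_nat d ^ E * ?L)"
    unfolding P(3) by (simp add: poly_0_coeff_0[symmetric] poly_prod prod_uminus s_def N_def mult_ac)
  finally have c: "to_closure (pcompose (column P 0) [:0, of_nat d:]) = of_int s * (of_nat d ^ E * ?L)" .
  have "to_closure (pcompose g [:0, of_nat d:]) = of_nat d ^ E * coeff (cycle_poly d m) 0"
    unfolding g N_def[symmetric] E_def[symmetric] multiplier_poly_factorization[OF d m, symmetric]
    by (simp add: to_closure_smult)
  also have "\<dots> = of_int t * (of_nat d ^ E * ?L)"
    using prod_cycles[OF m order_refl, of "derivative_at d" d]
    by (simp add: cycle_poly_def poly_0_coeff_0[symmetric] poly_prod prod_uminus t_def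
        cycle_multiplier_def cycle_set_partition(1)[OF m] mult_ac)
  finally have "to_closure (pcompose g [:0, of_nat d:]) = of_int t * (of_nat d ^ E * ?L)" .
  then have "to_closure (of_int s * pcompose g [:0, of_nat d:])
      = to_closure (of_int t * pcompose (column P 0) [:0, of_nat d:])"
    using c by (simp add: tc.hom_mult tc.hom_of_int)
  then have "pcompose (smult s g) [:0, of_nat d:] = pcompose (smult t (column P 0)) [:0, of_nat d:]"
    by (simp add: pcompose_smult of_int_poly)
  then have "smult s g = smult t (column P 0)"
    using d by - (rule pcompose_inject[of "[:0, of_nat d:]"], simp_all)
  then have "s * coeff g N = t * coeff (coeff P N) 0"
    by (metis coeff_smult coeff_column)
  moreover have "coeff (coeff P N) 0 = 1 \<or> coeff (coeff P N) 0 = - 1"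
    using P(1,2) by (auto simp: unit_lead_def)
  ultimately show ?thesis using st unfolding N_def by auto
qed

theorem theorem1p9:
  fixes d m :: nat
  assumes "d \<ge> 1" and "m \<ge> 1"
  shows "\<exists>P :: int poly poly.
           Polynomial.smult (of_nat d ^ (Polynomial.degree (dynatomic d m) div (d + 1)))
             (multiplier_poly d m) = subst_t P [:0, of_nat d:]
           \<and> (Polynomial.lead_coeff P = 1 \<or> Polynomial.lead_coeff P = - 1)"
proof -
  note d = assms(1) and m = assms(2)
  define q where "q = multiplier_poly d m"
  define N E M where "N = card (periodic_points d m)" and "E = N div (d + 1)"
    and "M = card (cycle_set d m)"
  have N: "N = m * M" by (simp add: N_def M_def card_periodic_points_eq[OF m])
  have deg_r: "degree [:0, of_nat d :: int:] = 1" using d by simp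
  have "\<exists>g. pcompose g [:0, of_nat d:] = smult (of_nat d ^ E) (coeff q j)" for j
  proof -
    have "to_closure (smult (of_nat d ^ E) (coeff q j)) = of_nat d ^ E * coeff (cycle_poly d m) j"
      unfolding multiplier_poly_factorization[OF d m, symmetric] q_def
      by (simp add: to_closure_smult)
    then show ?thesis
      using scaled_coeff_integral[OF d m, of j] integral_over_scaled_param[OF d]
      unfolding E_def N_def by metis
  qed
  then obtain g where g: "\<And>j. pcompose (g j) [:0, of_nat d:] = smult (of_nat d ^ E) (coeff q j)"
    by metis
  have deg_g: "degree (g j) \<le> m * (M - j)" for j
  proof -
    have "degree (g j) = degree (pcompose (g j) [:0, of_nat d:])" using d by (simp add: degree_pcompose)
    also have "\<dots> \<le> degree (coeff q j)" unfolding g by (rule degree_smult_le)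
    also have "\<dots> \<le> m * (M - j)"
      unfolding q_def M_def by (rule degree_multiplier_poly_coeff[OF d m])
    finally show ?thesis .
  qed
  have deg_q: "degree q = M"
  proof -
    have "degree (map_poly to_closure q) = M"
      unfolding q_def multiplier_poly_factorization[OF d m]
      by (simp add: cycle_poly_def degree_prod_sum_eq M_def)
    then show ?thesis by simp
  qed
  have g_0: "g j = 0" if "j > M" for j
    using g[of j] that pcompose_eq_0[of "g j" "[:0, of_nat d:]"] deg_r by (simp add: deg_q coeff_eq_0)
  obtain P where P: "\<And>j. column P j = g j"
    using exists_with_columns[of M g] g_0 by blast
  have coeff_P: "coeff (coeff P i) j = coeff (g j) i" for i j
    by (simp flip: P add: coeff_column)
  have "smult (of_nat d ^ E) q = subst_t P [:0, of_nat d:]"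
  proof (rule poly_eqI)
    fix j
    have "smult (of_nat d ^ E) (coeff q j) = of_nat d ^ E * coeff q j"
      by (simp add: of_nat_poly poly_const_pow)
    then show "coeff (smult (of_nat d ^ E) q) j = coeff (subst_t P [:0, of_nat d:]) j"
      by (simp add: coeff_subst_t P g)
  qed
  moreover have "lead_coeff P = 1 \<or> lead_coeff P = - 1"
  proof -
    \<comment> \<open>For \<open>j > 0\<close> the degree bound \<open>m (M - j)\<close> lies strictly below \<open>N = m M\<close>.\<close>
    have "coeff (coeff P N) j = (if j = 0 then coeff (g 0) N else 0)" for j
    proof (cases "j = 0 \<or> j > M")
      case False
      then have "m * (M - j) < N" using m unfolding N by simp
      then show ?thesis using False deg_g[of j] by (simp add: coeff_P coeff_eq_0)
    qed (auto simp: coeff_P g_0)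
    then have "coeff P N = [:coeff (g 0) N:]"
      by (intro poly_eqI) (simp add: coeff_pCons split: nat.split)
    moreover have "coeff (g 0) N = 1 \<or> coeff (g 0) N = - 1"
      unfolding N_def by (rule constant_column[OF d m g[of 0, unfolded E_def N_def q_def]])
    moreover have "[:1 :: int:] = 1" by simp
    moreover have "[:- 1 :: int:] = - 1"
      by (rule poly_eqI) (simp add: coeff_pCons split: nat.split)
    ultimately have top: "coeff P N = 1 \<or> coeff P N = - 1" by metis
    have "coeff P i = 0" if "i > N" for i
    proof (rule poly_eqI)
      fix j
      have "m * (M - j) \<le> N" unfolding N by simp
      then show "coeff (coeff P i) j = coeff 0 j"
        using that deg_g[of j] by (simp add: coeff_P coeff_eq_0)
    qed
    then have "degree P \<le> N" by (intro degree_le) simp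
    moreover have "degree P \<ge> N" using top by (intro le_degree) auto
    ultimately show ?thesis using top by simp
  qed
  ultimately show ?thesis
    unfolding degree_dynatomic[OF d m] q_def E_def N_def by blast
qed

end
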